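(* Let $I=[p,q)$ with $p<q$ be a half-closed interval of the real line and let $\mathcal{G}_I$ be the group of interval exchange transformations of $I$. The following four subgroups of $\mathcal{G}_I$ coincide: (i) the group of all $f\in\mathcal{G}_I$ with $\mathrm{Inv}(f)=0$; (ii) the commutator group of $\mathcal{G}_I$; (iii) the subgroup of $\mathcal{G}_I$ generated by all elements of order $2$; (iv) the subgroup of $\mathcal{G}_I$ generated by all elements of finite order.
   Context: An interval exchange transformation of $I=[p,q)$ is a bijection $f:I\to I$ for which there is a finite partition of $I$ into half-closed intervals $I_i=[p_{i-1},p_i)$, $p=p_0<p_1<\dots<p_k=q$, such that the restriction of $f$ to each $I_i$ is a translation $x\mapsto x+t_i$ (so the images $f(I_1),\dots,f(I_k)$ form another partition of $I$). All such maps form a group $\mathcal{G}_I$ under composition. The commutator group of $\mathcal{G}_I$ is the subgroup generated by all commutators $f^{-1}g^{-1}fg$, $f,g\in\mathcal{G}_I$. The scissors congruence (Sah-Arnoux-Fathi, SAF) invariant of $f$ is $\mathrm{Inv}(f)=\lambda_1\otimes t_1+\dots+\lambda_k\otimes t_k\in\mathbb{R}\otimes_{\mathbb{Q}}\mathbb{R}$, where $I=I_1\cup\dots\cup I_k$ is any partition into half-closed subintervals such that $f$ restricted to $I_i$ is the translation by $t_i$, and $\lambda_i$ is the length of $I_i$; this does not depend on the choice of the partition. *)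

theory Defs
  imports
    "HOL-Algebra.Bij"
    "HOL-Algebra.Generated_Groups"
    "HOL-Algebra.Multiplicative_Group"
    "HOL-Library.Poly_Mapping"
    "HOL-Analysis.Lebesgue_Measure"
begin

section \<open>The tensor product of the reals with themselves over the rationals\<close>

text \<open>
  The usual construction: the free abelian group on pairs of reals modulo the subgroup
  generated by the biadditivity relations and the relations that move a rational scalar
  from one factor to the other.
\<close>

inductive_set tensor_null :: "((real \<times> real) \<Rightarrow>\<^sub>0 int) set" where
  zero: "0 \<in> tensor_null"
| diff: "u \<in> tensor_null \<Longrightarrow> v \<in> tensor_null \<Longrightarrow> u - v \<in> tensor_null"
| add_left: "Poly_Mapping.single (x + x', y) 1 - Poly_Mapping.single (x, y) 1
    - Poly_Mapping.single (x', y) 1 \<in> tensor_null"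
| add_right: "Poly_Mapping.single (x, y + y') 1 - Poly_Mapping.single (x, y) 1
    - Poly_Mapping.single (x, y') 1 \<in> tensor_null"
| balanced: "Poly_Mapping.single (of_rat r * x, y) 1
    - Poly_Mapping.single (x, of_rat r * y) 1 \<in> tensor_null"

lemma tensor_null_uminus: "u \<in> tensor_null \<Longrightarrow> - u \<in> tensor_null"
  using tensor_null.diff[OF tensor_null.zero] by simp

lemma tensor_null_add: "u \<in> tensor_null \<Longrightarrow> v \<in> tensor_null \<Longrightarrow> u + v \<in> tensor_null"
  using tensor_null.diff[of u "- v"] tensor_null_uminus by simp

quotient_type real_tensor = "(real \<times> real) \<Rightarrow>\<^sub>0 int" / "\<lambda>u v. u - v \<in> tensor_null"
proof (rule equivpI)
  show "reflp (\<lambda>u v. u - v \<in> tensor_null)"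
    by (simp add: reflp_def tensor_null.zero)
  show "symp (\<lambda>u v. u - v \<in> tensor_null)"
    using tensor_null_uminus by (fastforce simp: symp_def)
  show "transp (\<lambda>u v. u - v \<in> tensor_null)"
    using tensor_null_add by (fastforce simp: transp_def)
qed

instantiation real_tensor :: ab_group_add
begin

lift_definition zero_real_tensor :: real_tensor is 0 .

lift_definition plus_real_tensor :: "real_tensor \<Rightarrow> real_tensor \<Rightarrow> real_tensor" is "(+)"
  using tensor_null_add by (simp add: add_diff_add)

lift_definition uminus_real_tensor :: "real_tensor \<Rightarrow> real_tensor" is uminus
  using tensor_null_uminus by fastforce

lift_definition minus_real_tensor :: "real_tensor \<Rightarrow> real_tensor \<Rightarrow> real_tensor" is "(-)"
proof -
  fix a b c d :: "(real \<times> real) \<Rightarrow>\<^sub>0 int"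
  assume "a - b \<in> tensor_null" "c - d \<in> tensor_null"
  then have "(a - b) - (c - d) \<in> tensor_null" by (rule tensor_null.diff)
  then show "(a - c) - (b - d) \<in> tensor_null" by (simp add: algebra_simps)
qed

instance
  by standard (transfer, simp add: tensor_null.zero algebra_simps)+

end

lift_definition tensor :: "real \<Rightarrow> real \<Rightarrow> real_tensor"
  is "\<lambda>x y. Poly_Mapping.single (x, y) 1" .

lemma tensor_add_left: "tensor (x + x') y = tensor x y + tensor x' y"
  by transfer (use tensor_null.add_left in \<open>simp add: diff_diff_eq\<close>)

lemma tensor_add_right: "tensor x (y + y') = tensor x y + tensor x y'"
  by transfer (use tensor_null.add_right in \<open>simp add: diff_diff_eq\<close>)

lemma tensor_balanced: "tensor (of_rat r * x) y = tensor x (of_rat r * y)"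
  by transfer (rule tensor_null.balanced)

lemma tensor_zero_left: "tensor 0 y = 0"
  using tensor_add_left[of 0 0 y] by simp

lemma tensor_sum_left: "tensor (\<Sum>i\<in>A. g i) y = (\<Sum>i\<in>A. tensor (g i) y)"
  by (induction A rule: infinite_finite_induct) (auto simp: tensor_zero_left tensor_add_left)


section \<open>Interval exchange transformations\<close>

text \<open>
  The pieces of \<open>[p, q)\<close> are \<open>[c i, c (i + 1))\<close> for \<open>i < k\<close>, and \<open>f\<close> translates the
  \<open>i\<close>-th piece by \<open>t i\<close>; the values of \<open>c\<close> beyond \<open>k\<close> and of \<open>t\<close> from \<open>k\<close> on play no role.
\<close>

definition exchange_partition ::
  "real \<Rightarrow> real \<Rightarrow> (real \<Rightarrow> real) \<Rightarrow> nat \<Rightarrow> (nat \<Rightarrow> real) \<Rightarrow> (nat \<Rightarrow> real) \<Rightarrow> bool" where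
  "exchange_partition p q f k c t \<longleftrightarrow>
     c 0 = p \<and> c k = q \<and> (\<forall>i<k. c i < c (Suc i)) \<and>
     (\<forall>i<k. \<forall>x\<in>{c i..<c (Suc i)}. f x = x + t i)"

text \<open>
  Transformations of \<open>[p, q)\<close> are represented by functions that are \<^const>\<open>undefined\<close>
  outside \<open>[p, q)\<close>, as in \<^const>\<open>BijGroup\<close>; the product of \<open>f\<close> and \<open>g\<close> is \<open>f\<close> after \<open>g\<close>.
\<close>

definition IET :: "real \<Rightarrow> real \<Rightarrow> (real \<Rightarrow> real) set" where
  "IET p q = {f \<in> Bij {p..<q}. \<exists>k c t. exchange_partition p q f k c t}"

definition IET_group :: "real \<Rightarrow> real \<Rightarrow> (real \<Rightarrow> real) monoid" where
  "IET_group p q = BijGroup {p..<q} \<lparr>carrier := IET p q\<rparr>"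

text \<open>The description below is definite by \<open>SAF_eq\<close>: all partitions give the same value.\<close>

definition SAF :: "real \<Rightarrow> real \<Rightarrow> (real \<Rightarrow> real) \<Rightarrow> real_tensor" where
  "SAF p q f = (THE v. \<exists>k c t. exchange_partition p q f k c t \<and>
                  v = (\<Sum>i<k. tensor (c (Suc i) - c i) (t i)))"


subsection \<open>The invariant does not depend on the partition\<close>

lemma exchange_partition_mono:
  assumes "exchange_partition p q f k c t" "i \<le> j" "j \<le> k"
  shows "c i \<le> c j"
  using assms(2,3)
proof (induction j rule: dec_induct)
  case (step n)
  then have "c i \<le> c n" by simp
  also have "c n < c (Suc n)" using step assms(1) by (simp add: exchange_partition_def)
  finally show ?case by simp
qed simp

lemma exchange_partition_ex:
  assumes "exchange_partition p q f k c t" "x \<in> {p..<q}"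
  shows "\<exists>i<k. x \<in> {c i..<c (Suc i)}"
proof -
  have "x < c j \<Longrightarrow> j \<le> k \<Longrightarrow> \<exists>i<k. x \<in> {c i..<c (Suc i)}" for j
  proof (induction j)
    case 0
    then show ?case using assms by (auto simp: exchange_partition_def)
  next
    case (Suc j)
    then show ?case
      by (metis Suc_le_eq atLeastLessThan_iff less_or_eq_imp_le not_less)
  qed
  from this[of k] show ?thesis using assms by (auto simp: exchange_partition_def)
qed

lemma exchange_partition_sub:
  assumes "exchange_partition p q f k c t" "i < k"
  shows "{c i..<c (Suc i)} \<subseteq> {p..<q}"
  using exchange_partition_mono[OF assms(1), of 0 i] exchange_partition_mono[OF assms(1), of "Suc i" k]
    assms by (auto simp: exchange_partition_def)

lemma exchange_partition_disj:
  assumes "exchange_partition p q f k c t"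
  shows "disjoint_family_on (\<lambda>i. {c i..<c (Suc i)}) {..<k}"
proof -
  have "{c i..<c (Suc i)} \<inter> {c j..<c (Suc j)} = {}" if "i < j" "j < k" for i j
    using exchange_partition_mono[OF assms, of "Suc i" j] that by auto
  then show ?thesis
    unfolding disjoint_family_on_def by (metis Int_commute lessThan_iff linorder_neqE_nat)
qed

lemma exchange_sum_canonical:
  assumes P: "exchange_partition p q f k c t"
  shows "(\<Sum>i<k. tensor (c (Suc i) - c i) (t i)) =
    (\<Sum>v\<in>(\<lambda>x. f x - x) ` {p..<q}. tensor (measure lborel {x\<in>{p..<q}. f x - x = v}) v)"
proof -
  have lt: "c i < c (Suc i)" if "i < k" for i
    using P that by (auto simp: exchange_partition_def)
  have f: "f x - x = t i" if "i < k" "x \<in> {c i..<c (Suc i)}" for i x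
    using P that by (auto simp: exchange_partition_def)
  have T: "(\<lambda>x. f x - x) ` {p..<q} = t ` {..<k}"
  proof (intro equalityI subsetI)
    fix v assume "v \<in> (\<lambda>x. f x - x) ` {p..<q}"
    then obtain x where x: "x \<in> {p..<q}" "v = f x - x" by auto
    then obtain i where "i < k" "x \<in> {c i..<c (Suc i)}"
      using exchange_partition_ex[OF P] by blast
    with x f show "v \<in> t ` {..<k}" by auto
  next
    fix v assume "v \<in> t ` {..<k}"
    then obtain i where i: "i < k" "v = t i" by auto
    then have "c i \<in> {c i..<c (Suc i)}" using lt by auto
    then have "v = f (c i) - c i" "c i \<in> {p..<q}"
      using f[OF i(1)] exchange_partition_sub[OF P i(1)] i(2) by auto
    then show "v \<in> (\<lambda>x. f x - x) ` {p..<q}" by (rule image_eqI)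
  qed
  have M: "measure lborel {x\<in>{p..<q}. f x - x = v} = (\<Sum>i\<in>{i\<in>{..<k}. t i = v}. c (Suc i) - c i)" for v
  proof -
    have "{x\<in>{p..<q}. f x - x = v} = (\<Union>i\<in>{i\<in>{..<k}. t i = v}. {c i..<c (Suc i)})"
    proof (intro equalityI subsetI)
      fix x assume x: "x \<in> {x\<in>{p..<q}. f x - x = v}"
      then obtain i where "i < k" "x \<in> {c i..<c (Suc i)}"
        using exchange_partition_ex[OF P] by blast
      with x f show "x \<in> (\<Union>i\<in>{i\<in>{..<k}. t i = v}. {c i..<c (Suc i)})" by auto
    next
      fix x assume "x \<in> (\<Union>i\<in>{i\<in>{..<k}. t i = v}. {c i..<c (Suc i)})"
      then obtain i where "i < k" "t i = v" "x \<in> {c i..<c (Suc i)}" by blast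
      then show "x \<in> {x\<in>{p..<q}. f x - x = v}"
        using f exchange_partition_sub[OF P] by blast
    qed
    moreover have "measure lborel (\<Union>i\<in>{i\<in>{..<k}. t i = v}. {c i..<c (Suc i)}) =
        (\<Sum>i\<in>{i\<in>{..<k}. t i = v}. measure lborel {c i..<c (Suc i)})"
      by (rule measure_finite_Union)
        (auto intro: disjoint_family_on_mono[OF _ exchange_partition_disj[OF P]] simp: less_imp_le lt)
    ultimately show ?thesis by (simp add: less_imp_le lt)
  qed
  have "(\<Sum>i<k. tensor (c (Suc i) - c i) (t i)) =
      (\<Sum>v\<in>t ` {..<k}. \<Sum>i\<in>{i\<in>{..<k}. t i = v}. tensor (c (Suc i) - c i) (t i))"
    by (rule sum.image_gen) simp
  also have "\<dots> = (\<Sum>v\<in>t ` {..<k}. tensor (measure lborel {x\<in>{p..<q}. f x - x = v}) v)"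
    unfolding M tensor_sum_left by (intro sum.cong) auto
  finally show ?thesis unfolding T .
qed

lemma SAF_eq:
  assumes "exchange_partition p q f k c t"
  shows "SAF p q f = (\<Sum>i<k. tensor (c (Suc i) - c i) (t i))"
  unfolding SAF_def
proof (rule the_equality)
  show "\<exists>k' c' t'. exchange_partition p q f k' c' t' \<and>
      (\<Sum>i<k. tensor (c (Suc i) - c i) (t i)) = (\<Sum>i<k'. tensor (c' (Suc i) - c' i) (t' i))"
    using assms by blast
next
  fix v
  assume "\<exists>k c t. exchange_partition p q f k c t \<and> v = (\<Sum>i<k. tensor (c (Suc i) - c i) (t i))"
  then show "v = (\<Sum>i<k. tensor (c (Suc i) - c i) (t i))"
    using exchange_sum_canonical assms by fastforce
qed


subsection \<open>Interval exchange transformations form a group\<close>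

lemma exchange_partition_breaks:
  "(\<exists>k c t. exchange_partition p q f k c t) \<longleftrightarrow>
   p \<le> q \<and> (\<exists>A. finite A \<and> (\<forall>x\<in>{p..<q}. \<forall>y\<in>{p..<q}. x \<le> y \<longrightarrow> A \<inter> {x<..y} = {} \<longrightarrow> f y - y = f x - x))"
  (is "?L \<longleftrightarrow> ?R")
proof
  assume ?L
  then obtain k c t where P: "exchange_partition p q f k c t" by blast
  have key: "f y - y = f x - x"
    if xy: "x \<in> {p..<q}" "y \<in> {p..<q}" "x \<le> y" "c ` {..k} \<inter> {x<..y} = {}" for x y
  proof -
    obtain i where i: "i < k" "x \<in> {c i..<c (Suc i)}"
      using exchange_partition_ex[OF P xy(1)] by blast
    have "c (Suc i) \<notin> {x<..y}" using xy(4) i(1) by (auto simp: disjoint_iff)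
    then have "y \<in> {c i..<c (Suc i)}" using i xy by auto
    then show ?thesis using P i by (auto simp: exchange_partition_def)
  qed
  have pq: "p \<le> q"
    using exchange_partition_mono[OF P, of 0 k] P by (simp add: exchange_partition_def)
  have fin: "finite (c ` {..k})" by simp
  show ?R
    by (intro conjI exI[of _ "c ` {..k}"] ballI impI) (rule pq fin key; assumption)+
next
  assume ?R
  then obtain A where pq: "p \<le> q" and A: "finite A"
    "\<And>x y. x \<in> {p..<q} \<Longrightarrow> y \<in> {p..<q} \<Longrightarrow> x \<le> y \<Longrightarrow> A \<inter> {x<..y} = {} \<Longrightarrow> f y - y = f x - x"
    by blast
  define B where "B = insert p (insert q (A \<inter> {p..q}))"
  have B: "finite B" "p \<in> B" "q \<in> B" "B \<subseteq> {p..q}" using A pq by (auto simp: B_def)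
  define s where "s = sorted_list_of_set B"
  have s: "set s = B" "sorted_wrt (<) s" using B by (auto simp: s_def strict_sorted_list_of_set)
  define k where "k = length s - 1"
  have k: "length s = Suc k" using s B by (cases s) (auto simp: k_def)
  have nth_less: "s ! i < s ! j" if "i < j" "j \<le> k" for i j
    using sorted_wrt_nth_less[OF s(2)] that k by auto
  have nth_B: "s ! i \<in> B" if "i \<le> k" for i using s k that by (metis less_Suc_eq_le nth_mem)
  have ex_nth: "\<exists>i\<le>k. b = s ! i" if "b \<in> B" for b
    using s k that by (metis in_set_conv_nth less_Suc_eq_le)
  have 0: "s ! 0 = p"
  proof -
    obtain i where i: "i \<le> k" "p = s ! i" using ex_nth B by blast
    then show ?thesis using nth_less[of 0 i] nth_B[of 0] B(4) by (cases "i = 0") auto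
  qed
  have 1: "s ! k = q"
  proof -
    obtain i where i: "i \<le> k" "q = s ! i" using ex_nth B by blast
    then show ?thesis using nth_less[of i k] nth_B[of k] B(4) by (cases "i = k") auto
  qed
  have 2: "f x = x + (f (s ! i) - s ! i)" if i: "i < k" and x: "x \<in> {s ! i..<s ! Suc i}" for i x
  proof -
    have r: "s ! i \<in> {p..q}" "s ! Suc i \<in> {p..q}"
      using nth_B[of i] nth_B[of "Suc i"] i B by auto
    have "b \<notin> B" if b: "b \<in> {s ! i<..<s ! Suc i}" for b
    proof
      assume "b \<in> B"
      then obtain j where j: "j \<le> k" "b = s ! j" using ex_nth by blast
      have "i < j" using b j nth_less[of j i] i by (cases i j rule: linorder_cases) auto
      moreover have "j < Suc i"
        using b j nth_less[of "Suc i" j] i by (cases j "Suc i" rule: linorder_cases) auto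
      ultimately show False by simp
    qed
    moreover have "b \<in> B" "b \<in> {s ! i<..<s ! Suc i}" if "b \<in> A" "b \<in> {s ! i<..x}" for b
      using that x r by (auto simp: B_def)
    ultimately have "A \<inter> {s ! i<..x} = {}" by blast
    moreover have "s ! i \<in> {p..<q}" "x \<in> {p..<q}" "s ! i \<le> x" using x r by auto
    ultimately have "f x - x = f (s ! i) - s ! i" by (intro A(2))
    then show ?thesis by simp
  qed
  have "exchange_partition p q f k ((!) s) (\<lambda>i. f (s ! i) - s ! i)"
    unfolding exchange_partition_def by (intro conjI allI impI ballI 0 1 2 nth_less) simp_all
  then show ?L by blast
qed

lemma IET_compose:
  assumes f: "f \<in> IET p q" and g: "g \<in> IET p q"
  shows "compose {p..<q} f g \<in> IET p q"
proof -
  let ?I = "{p..<q}"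
  have fB: "f \<in> Bij ?I" and gB: "g \<in> Bij ?I" using f g by (auto simp: IET_def)
  have bij: "bij_betw g ?I ?I" using gB by (simp add: Bij_def)
  obtain A where pq: "p \<le> q" and A: "finite A"
    "\<And>x y. x \<in> ?I \<Longrightarrow> y \<in> ?I \<Longrightarrow> x \<le> y \<Longrightarrow> A \<inter> {x<..y} = {} \<Longrightarrow> f y - y = f x - x"
    using f unfolding IET_def exchange_partition_breaks by blast
  obtain B where B: "finite B"
    "\<And>x y. x \<in> ?I \<Longrightarrow> y \<in> ?I \<Longrightarrow> x \<le> y \<Longrightarrow> B \<inter> {x<..y} = {} \<Longrightarrow> g y - y = g x - x"
    using g unfolding IET_def exchange_partition_breaks by blast
  define C where "C = B \<union> (g -` A \<inter> ?I)"
  have fin: "finite C" unfolding C_def using A(1) B(1) bij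
    by (auto intro: finite_vimage_IntI simp: bij_betw_def)
  have key: "compose ?I f g y - y = compose ?I f g x - x"
    if xy: "x \<in> ?I" "y \<in> ?I" "x \<le> y" "C \<inter> {x<..y} = {}" for x y
  proof -
    have gt: "g z - z = g x - x" if "z \<in> {x..y}" for z
      using that xy by (intro B(2)) (auto simp: C_def disjoint_iff)
    have gI: "g x \<in> ?I" "g y \<in> ?I" using bij xy by (auto dest: bij_betwE)
    have "A \<inter> {g x<..g y} = {}"
    proof (rule ccontr)
      assume "A \<inter> {g x<..g y} \<noteq> {}"
      then obtain a where a: "a \<in> A" "g x < a" "a \<le> g y" by auto
      define z where "z = a - (g x - x)"
      have z: "z \<in> {x<..y}" using a gt[of y] xy by (auto simp: z_def)
      then have "g z = a" using gt[of z] by (auto simp: z_def)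
      then have "z \<in> C" using z a xy by (auto simp: C_def)
      then show False using z xy by blast
    qed
    then have "f (g y) - g y = f (g x) - g x"
      using gI gt[of y] xy by (intro A(2)) auto
    then show ?thesis using gt[of y] xy by (auto simp: compose_def)
  qed
  show ?thesis
    unfolding IET_def exchange_partition_breaks
  proof (intro CollectI conjI exI[of _ C] ballI impI)
    show "compose ?I f g \<in> Bij ?I" using fB gB by (rule compose_Bij)
  qed (rule pq fin key; assumption)+
qed

lemma IET_inv:
  assumes f: "f \<in> IET p q"
  shows "restrict (inv_into {p..<q} f) {p..<q} \<in> IET p q"
proof -
  let ?I = "{p..<q}"
  let ?h = "restrict (inv_into ?I f) ?I"
  have fB: "f \<in> Bij ?I" using f by (auto simp: IET_def)
  have bij: "bij_betw f ?I ?I" using fB by (simp add: Bij_def)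
  have inj: "u = v" if "f u = f v" "u \<in> ?I" "v \<in> ?I" for u v
    using that bij by (auto simp: bij_betw_def dest: inj_onD)
  have surj: "\<exists>x\<in>?I. f x = w" if "w \<in> ?I" for w
    using that bij by (metis bij_betw_imp_surj_on imageE)
  obtain k c t where P: "exchange_partition p q f k c t" using f by (auto simp: IET_def)
  have pq: "p \<le> q"
    using exchange_partition_mono[OF P, of 0 k] P by (simp add: exchange_partition_def)
  have ft: "f x = x + t i" if "i < k" "x \<in> {c i..<c (Suc i)}" for i x
    using P that by (auto simp: exchange_partition_def)
  have hx: "?h (f x) = x" if "x \<in> ?I" for x
  proof -
    have "f x \<in> ?I" using that bij by (rule bij_betw_apply[rotated])
    moreover have "inv_into ?I f (f x) = x" using bij that by (rule bij_betw_inv_into_left)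
    ultimately show ?thesis by (simp only: restrict_apply if_True)
  qed
  have key: "?h v - v = ?h u - u"
    if uv: "u \<in> ?I" "v \<in> ?I" "u \<le> v" "f ` c ` {..k} \<inter> {u<..v} = {}" for u v
  proof -
    obtain x where x: "x \<in> ?I" "f x = u" using surj[OF uv(1)] by blast
    obtain i where i: "i < k" "x \<in> {c i..<c (Suc i)}"
      using exchange_partition_ex[OF P x(1)] by blast
    have ux: "u = x + t i" using ft[OF i] x by simp
    have "v < c (Suc i) + t i"
    proof (rule ccontr)
      assume "\<not> v < c (Suc i) + t i"
      then have w: "c (Suc i) + t i \<in> {u<..v}" using i ux by auto
      then have "c (Suc i) + t i \<in> ?I" using uv by auto
      then obtain z where z: "z \<in> ?I" "f z = c (Suc i) + t i" using surj by blast
      obtain j where j: "j < k" "z \<in> {c j..<c (Suc j)}"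
        using exchange_partition_ex[OF P z(1)] by blast
      have fz: "f z = z + t j" using ft[OF j] .
      have "f z \<notin> f ` c ` {..k}" unfolding z(2) using w uv(4) by blast
      moreover have "f (c j) \<in> f ` c ` {..k}" using j(1) by simp
      ultimately have "z \<noteq> c j" by metis
      then have zj: "c j < z" using j by auto
      define e where "e = min (z - c j) (c (Suc i) - c i) / 2"
      have lti: "c i < c (Suc i)" using i by auto
      have e: "0 < e" "e < z - c j" "e < c (Suc i) - c i"
        using zj lti by (auto simp: e_def min_def)
      have a: "z - e \<in> {c j..<c (Suc j)}" using e j by auto
      have b: "c (Suc i) - e \<in> {c i..<c (Suc i)}" using e by auto
      have "f (z - e) = f (c (Suc i) - e)" using ft[OF j(1) a] ft[OF i(1) b] fz z(2) by simp
      moreover have "z - e \<in> ?I" using a exchange_partition_sub[OF P j(1)] by (rule subsetD[rotated])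
      moreover have "c (Suc i) - e \<in> ?I"
        using b exchange_partition_sub[OF P i(1)] by (rule subsetD[rotated])
      ultimately have "z - e = c (Suc i) - e" by (rule inj)
      then have eq: "z = c (Suc i)" by simp
      have "f (c (Suc i)) \<in> f ` c ` {..k}" using i(1) by simp
      moreover have "f (c (Suc i)) \<in> {u<..v}" using w by (simp only: z(2)[unfolded eq])
      ultimately have "f (c (Suc i)) \<in> f ` c ` {..k} \<inter> {u<..v}" by (rule IntI)
      then show False unfolding uv(4) by (rule emptyE)
    qed
    then have y: "v - t i \<in> {c i..<c (Suc i)}" using uv ux i by auto
    then have fv: "f (v - t i) = v" using ft[OF i(1)] by simp
    have "v - t i \<in> ?I" using y exchange_partition_sub[OF P i(1)] by (rule subsetD[rotated])
    then have "?h v = v - t i" using hx[of "v - t i"] unfolding fv by blast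
    moreover have "?h u = x" using hx[OF x(1)] unfolding x(2) .
    ultimately show ?thesis using ux by linarith
  qed
  show ?thesis
    unfolding IET_def exchange_partition_breaks
  proof (intro CollectI conjI exI[of _ "f ` c ` {..k}"] ballI impI)
    show "?h \<in> Bij ?I" using fB by (rule restrict_inv_into_Bij)
    show "finite (f ` c ` {..k})" by simp
  qed (rule pq key; assumption)+
qed

lemma IET_id:
  assumes "p \<le> q" shows "(\<lambda>x\<in>{p..<q}. x) \<in> IET p q"
proof -
  have "\<forall>x\<in>{p..<q}. \<forall>y\<in>{p..<q}. x \<le> y \<longrightarrow> {} \<inter> {x<..y} = {} \<longrightarrow>
      (\<lambda>x\<in>{p..<q}. x) y - y = (\<lambda>x\<in>{p..<q}. x) x - x"
    by simp
  then show ?thesis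
    unfolding IET_def exchange_partition_breaks using assms id_Bij finite.emptyI by blast
qed

lemma group_IET_group:
  assumes "p \<le> q" shows "group (IET_group p q)"
proof -
  interpret B: group "BijGroup {p..<q}" by (rule group_BijGroup)
  have sub: "IET p q \<subseteq> Bij {p..<q}" by (auto simp: IET_def)
  have inv: "inv\<^bsub>BijGroup {p..<q}\<^esub> f = restrict (inv_into {p..<q} f) {p..<q}"
    if "f \<in> Bij {p..<q}" for f
    using that by (intro B.inv_equality)
      (simp_all add: BijGroup_def restrict_inv_into_Bij Bij_compose_restrict_eq)
  have "subgroup (IET p q) (BijGroup {p..<q})"
  proof (rule B.subgroupI)
    show "IET p q \<subseteq> carrier (BijGroup {p..<q})" using sub by (simp add: BijGroup_def)
    show "IET p q \<noteq> {}" using IET_id[OF assms] by blast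
    fix f assume f: "f \<in> IET p q"
    then show "inv\<^bsub>BijGroup {p..<q}\<^esub> f \<in> IET p q"
      using IET_inv[OF f] inv sub by (simp add: subset_iff)
    fix g assume g: "g \<in> IET p q"
    show "f \<otimes>\<^bsub>BijGroup {p..<q}\<^esub> g \<in> IET p q"
      using IET_compose[OF f g] f g sub by (simp add: BijGroup_def subset_iff)
  qed
  then show ?thesis
    unfolding IET_group_def by (rule B.subgroup_imp_group)
qed

text \<open>
  \<^const>\<open>derived\<close> uses the commutators \<open>f g f\<^sup>-\<^sup>1 g\<^sup>-\<^sup>1\<close>; the convention \<open>f\<^sup>-\<^sup>1 g\<^sup>-\<^sup>1 f g\<close>
  gives the same subgroup.
\<close>

lemma (in group) derived_carrier_eq:
  "derived G (carrier G) =
   generate G {inv f \<otimes> inv g \<otimes> f \<otimes> g | f g. f \<in> carrier G \<and> g \<in> carrier G}"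
proof -
  have "derived_set G (carrier G) =
      {inv f \<otimes> inv g \<otimes> f \<otimes> g | f g. f \<in> carrier G \<and> g \<in> carrier G}" (is "_ = ?R")
  proof (intro equalityI subsetI)
    fix x assume "x \<in> derived_set G (carrier G)"
    then obtain f g where fg: "f \<in> carrier G" "g \<in> carrier G"
      and x: "x = f \<otimes> g \<otimes> inv f \<otimes> inv g" by blast
    have "x = inv (inv f) \<otimes> inv (inv g) \<otimes> inv f \<otimes> inv g" unfolding x using fg by simp
    then show "x \<in> ?R"
      by (intro CollectI exI[of _ "inv f"] exI[of _ "inv g"] conjI inv_closed fg)
  next
    fix x assume "x \<in> ?R"
    then obtain f g where fg: "f \<in> carrier G" "g \<in> carrier G"
      and x: "x = inv f \<otimes> inv g \<otimes> f \<otimes> g" by blast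
    have "x = inv f \<otimes> inv g \<otimes> inv (inv f) \<otimes> inv (inv g)" unfolding x using fg by simp
    then show "x \<in> derived_set G (carrier G)"
      by (intro UN_I[of "inv f"] UN_I[of "inv g"] inv_closed fg) (simp only: singleton_iff)
  qed
  then show ?thesis by (simp only: derived_def)
qed

end

theory Submission
  imports Defs
begin

text \<open>
  Write \<open>K\<close>, \<open>D\<close>, \<open>T\<close>, \<open>F\<close> for the kernel of the invariant, the commutator group, and the
  subgroups generated by the involutions and by the elements of finite order.

  The invariant is a homomorphism to \<open>\<real> \<otimes> \<real>\<close> (\<open>SAF_compose\<close>): the displacement of \<open>f \<circ> g\<close> is the
  displacement of \<open>g\<close> plus that of \<open>f\<close> transported by \<open>g\<close>, and \<open>g\<close> preserves length. Its target is
  abelian, so \<open>D \<subseteq> K\<close>, and torsion-free (\<open>tensor_torsion_free\<close>), so \<open>T \<subseteq> F \<subseteq> K\<close>. What is left is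
  \<open>K \<subseteq> D\<close> and \<open>K \<subseteq> T\<close>. Both \<open>D\<close> and \<open>T\<close> are normal and contain every swap of two disjoint intervals
  of equal length: such a swap is an involution (\<open>ord_interval_swap\<close>), and it is the commutator of
  two involutions that permute the halves of its intervals (\<open>interval_swap_in_derived\<close>). Hence it
  suffices that a normal subgroup \<open>N\<close> containing all swaps contains \<open>K\<close>
  (\<open>SAF_kernel_subset_normal\<close>).

  Let \<open>f \<in> K\<close>. The lengths of the pieces of \<open>f\<close> are sums of elements of a finite set \<open>L\<close> of positive
  numbers that are linearly independent and as small as desired
  (\<open>nat_span_small_independent_generators\<close>), so the pieces can be cut until all lengths lie in \<open>L\<close>.
  Sorting the pieces by transposing neighbours writes \<open>f\<close> as a product of exchanges of two adjacent
  intervals of lengths \<open>a, b \<in> L\<close> (\<open>IET_generated_by_adjacent_exchanges\<close>). Modulo \<open>N\<close> such an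
  exchange depends on \<open>(a, b)\<close> only, because a swap conjugates one location into another; since the
  lengths are small, two exchanges can be moved apart, so all of them commute modulo \<open>N\<close>. The
  exchange of type \<open>(a, a)\<close> is a swap, those of types \<open>(a, b)\<close> and \<open>(b, a)\<close> are inverse to each
  other, and the invariant of type \<open>(a, b)\<close> is \<open>a \<otimes> b - b \<otimes> a\<close>. By independence of \<open>L\<close>, the vanishing
  of the invariant of \<open>f\<close> means that for \<open>a \<noteq> b\<close> the types \<open>(a, b)\<close> and \<open>(b, a)\<close> occur equally often
  (\<open>tensor_wedge_counts\<close>), so that the product is trivial modulo \<open>N\<close>.
\<close>


section \<open>Tensors of real numbers\<close>

lemma tensor_uminus_right: "tensor x (- y) = - tensor x y"
  using tensor_add_right[of x y "- y"] tensor_add_right[of x 0 0]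
  by (simp add: add_eq_0_iff)

text \<open>
  The universal property of the tensor product, for real-valued maps. The linear extension of
  \<open>\<beta>\<close> to formal sums kills the generators of \<^const>\<open>tensor_null\<close>, hence descends to the quotient.
\<close>

lemma tensor_functional:
  fixes \<beta> :: "real \<Rightarrow> real \<Rightarrow> real"
  assumes add_left: "\<And>x x' y. \<beta> (x + x') y = \<beta> x y + \<beta> x' y"
    and add_right: "\<And>x y y'. \<beta> x (y + y') = \<beta> x y + \<beta> x y'"
    and balanced: "\<And>r x y. \<beta> (of_rat r * x) y = \<beta> x (of_rat r * y)"
  obtains ev :: "real_tensor \<Rightarrow> real"
  where "\<And>u v. ev (u + v) = ev u + ev v" "\<And>u v. ev (u - v) = ev u - ev v"
    "\<And>x y. ev (tensor x y) = \<beta> x y"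
proof -
  define E :: "((real \<times> real) \<Rightarrow>\<^sub>0 int) \<Rightarrow> real"
    where "E u = (\<Sum>k\<in>Poly_Mapping.keys u. of_int (Poly_Mapping.lookup u k) * \<beta> (fst k) (snd k))" for u
  have E_superset: "E u = (\<Sum>k\<in>K. of_int (Poly_Mapping.lookup u k) * \<beta> (fst k) (snd k))"
    if "finite K" "Poly_Mapping.keys u \<subseteq> K" for u K
    unfolding E_def using that by (intro sum.mono_neutral_left) (auto simp: in_keys_iff)
  have E_diff: "E (u - v) = E u - E v" for u v
  proof -
    let ?K = "Poly_Mapping.keys u \<union> Poly_Mapping.keys v"
    have "Poly_Mapping.keys (u - v) \<subseteq> ?K"
      by (auto simp: in_keys_iff lookup_minus)
    then show ?thesis
      by (subst (1 2 3) E_superset[of ?K])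
        (auto simp: lookup_minus sum_subtractf left_diff_distrib)
  qed
  have E_single: "E (Poly_Mapping.single (x, y) 1) = \<beta> x y" for x y
    by (simp add: E_def)
  have E_null: "E u = 0" if "u \<in> tensor_null" for u
    using that by induction (simp_all add: E_diff E_single assms, simp add: E_def)
  define ev where "ev T = E (rep_real_tensor T)" for T
  have ev_abs: "ev (abs_real_tensor u) = E u" for u
  proof -
    have "rep_real_tensor (abs_real_tensor u) - u \<in> tensor_null"
      using Quotient_rep_abs[OF Quotient_real_tensor, of u] by (simp add: tensor_null.zero)
    then show ?thesis using E_null E_diff unfolding ev_def by fastforce
  qed
  have abs: "T = abs_real_tensor (rep_real_tensor T)" for T
    using Quotient_abs_rep[OF Quotient_real_tensor] by simp
  have d: "ev (u - v) = ev u - ev v" for u v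
    by (subst (1) abs[of u], subst (1) abs[of v])
      (simp only: minus_real_tensor.abs_eq ev_abs E_diff, simp add: ev_def)
  show ?thesis
  proof
    show "ev (u - v) = ev u - ev v" for u v by (rule d)
    show "ev (u + v) = ev u + ev v" for u v
      using d[of "u + v" v] by simp
    show "ev (tensor x y) = \<beta> x y" for x y
      by (simp add: tensor.abs_eq ev_abs E_single)
  qed
qed

text \<open>
  Multiplication by a real number on the first factor; for \<open>c = 1 / n\<close> it undoes multiplication by \<open>n\<close>.
\<close>

lift_definition tensor_scale :: "real \<Rightarrow> real_tensor \<Rightarrow> real_tensor"
  is "\<lambda>c. frag_extend (\<lambda>(x, y). Poly_Mapping.single (c * x, y) 1)"
proof -
  fix c :: real and u v :: "(real \<times> real) \<Rightarrow>\<^sub>0 int"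
  let ?T = "frag_extend (\<lambda>(x, y). Poly_Mapping.single (c * x, y) (1::int))"
  have single: "?T (Poly_Mapping.single (x, y) 1) = Poly_Mapping.single (c * x, y) 1" for x y
    using frag_extend_of[of "\<lambda>(x, y). Poly_Mapping.single (c * x, y) (1::int)" "(x, y)"] by simp
  have "?T w \<in> tensor_null" if "w \<in> tensor_null" for w
    using that
  proof induction
    case (balanced r x y)
    show ?case
      using tensor_null.balanced[of r "c * x" y]
      by (simp add: frag_extend_diff single mult.left_commute)
  qed (simp_all add: frag_extend_diff single distrib_left tensor_null.intros)
  moreover assume "u - v \<in> tensor_null"
  ultimately show "?T u - ?T v \<in> tensor_null" by (simp flip: frag_extend_diff)
qed

lemma tensor_scale_add: "tensor_scale c (u + v) = tensor_scale c u + tensor_scale c v"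
  by transfer (simp add: frag_extend_add tensor_null.zero)

lemma tensor_scale_0: "tensor_scale c 0 = 0"
  using tensor_scale_add[of c 0 0] by simp

lemma tensor_scale_sum: "tensor_scale c (\<Sum>i\<in>A. g i) = (\<Sum>i\<in>A. tensor_scale c (g i))"
  by (induction A rule: infinite_finite_induct) (auto simp: tensor_scale_0 tensor_scale_add)

lemma tensor_scale_tensor: "tensor_scale c (tensor x y) = tensor (c * x) y"
proof -
  have "frag_extend (\<lambda>(x, y). Poly_Mapping.single (c * x, y) (1::int)) (Poly_Mapping.single (x, y) 1)
      = Poly_Mapping.single (c * x, y) 1"
    using frag_extend_of[of "\<lambda>(x, y). Poly_Mapping.single (c * x, y) (1::int)" "(x, y)"] by simp
  then show ?thesis by transfer (simp add: tensor_null.zero)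
qed

text \<open>
  Scaling the first factors by \<open>1 / n\<close> turns the \<open>n\<close>-fold sum into the sum itself.
\<close>

lemma tensor_torsion_free:
  fixes n :: nat
  assumes "n > 0" and 0: "(\<Sum>j<n. \<Sum>i\<in>A. tensor (g i) (h i)) = 0"
  shows "(\<Sum>i\<in>A. tensor (g i) (h i)) = 0"
proof -
  have "0 = tensor_scale (1 / real n) (\<Sum>j<n. \<Sum>i\<in>A. tensor (g i) (h i))"
    by (simp add: 0 tensor_scale_0)
  also have "\<dots> = (\<Sum>i\<in>A. \<Sum>j<n. tensor (g i / real n) (h i))"
    by (subst sum.swap) (simp add: tensor_scale_sum tensor_scale_tensor)
  also have "\<dots> = (\<Sum>i\<in>A. tensor (g i) (h i))"
    using assms(1) by (simp flip: tensor_sum_left)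
  finally show ?thesis by simp
qed


section \<open>The invariant as the integral of the displacement\<close>

text \<open>
  The integral over \<open>[p, q)\<close> of a step function, with \<open>length \<otimes> value\<close> in place of
  \<open>length \<cdot> value\<close>. The invariant of \<open>f\<close> is the integral of the displacement \<open>f x - x\<close>, and it is a
  homomorphism because this integral is additive and invariant under length-preserving bijections.
\<close>

definition tensor_integral :: "real \<Rightarrow> real \<Rightarrow> (real \<Rightarrow> real) \<Rightarrow> real_tensor" where
  "tensor_integral p q h =
     (\<Sum>v\<in>h ` {p..<q}. tensor (measure lborel {x\<in>{p..<q}. h x = v}) v)"

text \<open>
  The values have an arbitrary type, so that a pair of step functions is again a step function;
  additivity of the integral is proved by passing to such pairs.
\<close>

definition step_on :: "real \<Rightarrow> real \<Rightarrow> (real \<Rightarrow> 'a) \<Rightarrow> bool" where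
  "step_on p q h \<longleftrightarrow> finite (h ` {p..<q}) \<and> (\<forall>v. {x\<in>{p..<q}. h x = v} \<in> sets borel)"

lemma emeasure_Collect_Ico_finite: "emeasure lborel {x\<in>{p..<q::real}. P x} \<noteq> \<infinity>"
proof -
  have "emeasure lborel {x\<in>{p..<q}. P x} \<le> emeasure lborel {p..<q}"
    by (intro emeasure_mono) auto
  also have "\<dots> < \<infinity>"
    by (cases "p \<le> q") auto
  finally show ?thesis by simp
qed

lemma step_on_Pair:
  assumes "step_on p q h" "step_on p q k"
  shows "step_on p q (\<lambda>x. (h x, k x))"
proof -
  have "finite (h ` {p..<q} \<times> k ` {p..<q})"
    using assms by (simp add: step_on_def)
  then have "finite ((\<lambda>x. (h x, k x)) ` {p..<q})"
    by (rule finite_subset[rotated]) auto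
  moreover have "{x\<in>{p..<q}. (h x, k x) = v} \<in> sets borel" for v
  proof -
    have "{x\<in>{p..<q}. (h x, k x) = v} = {x\<in>{p..<q}. h x = fst v} \<inter> {x\<in>{p..<q}. k x = snd v}"
      by auto
    then show ?thesis
      using assms by (simp only: step_on_def sets.Int)
  qed
  ultimately show ?thesis unfolding step_on_def by blast
qed

text \<open>
  Grouping the level sets of \<open>h\<close> by the value of \<open>F\<close> and using additivity of \<^const>\<open>tensor\<close> in
  its first argument.
\<close>

lemma tensor_integral_comp:
  fixes F :: "'a \<Rightarrow> real"
  assumes "step_on p q h"
  shows "tensor_integral p q (\<lambda>x. F (h x)) =
    (\<Sum>z\<in>h ` {p..<q}. tensor (measure lborel {x\<in>{p..<q}. h x = z}) (F z))"
proof -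
  let ?Z = "h ` {p..<q}"
  have fin: "finite ?Z" and meas: "{x\<in>{p..<q}. h x = z} \<in> sets borel" for z
    using assms by (auto simp: step_on_def)
  have M: "measure lborel {x\<in>{p..<q}. F (h x) = v} =
      (\<Sum>z\<in>{z\<in>?Z. F z = v}. measure lborel {x\<in>{p..<q}. h x = z})" for v
  proof -
    have "{x\<in>{p..<q}. F (h x) = v} = (\<Union>z\<in>{z\<in>?Z. F z = v}. {x\<in>{p..<q}. h x = z})" by auto
    moreover have "measure lborel (\<Union>z\<in>{z\<in>?Z. F z = v}. {x\<in>{p..<q}. h x = z}) =
        (\<Sum>z\<in>{z\<in>?Z. F z = v}. measure lborel {x\<in>{p..<q}. h x = z})"
      by (rule measure_finite_Union)
        (use fin meas emeasure_Collect_Ico_finite in \<open>auto simp: disjoint_family_on_def\<close>)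
    ultimately show ?thesis by simp
  qed
  have "(\<Sum>z\<in>?Z. tensor (measure lborel {x\<in>{p..<q}. h x = z}) (F z)) =
      (\<Sum>v\<in>F ` ?Z. \<Sum>z\<in>{z\<in>?Z. F z = v}. tensor (measure lborel {x\<in>{p..<q}. h x = z}) (F z))"
    by (rule sum.image_gen) (rule fin)
  also have "\<dots> = (\<Sum>v\<in>F ` ?Z. tensor (measure lborel {x\<in>{p..<q}. F (h x) = v}) v)"
    unfolding M tensor_sum_left by (intro sum.cong) auto
  finally show ?thesis by (simp add: tensor_integral_def image_image)
qed

text \<open>
  The three integrands are functions of the step function \<open>x \<mapsto> (h x, k x)\<close>, so all three integrals
  are sums over its values, where additivity of \<^const>\<open>tensor\<close> in its second argument applies.
\<close>

lemma tensor_integral_add: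
  assumes "step_on p q h" "step_on p q k"
  shows "tensor_integral p q (\<lambda>x. h x + k x) = tensor_integral p q h + tensor_integral p q k"
  using tensor_integral_comp[OF step_on_Pair[OF assms], of "\<lambda>z. fst z + snd z"]
    tensor_integral_comp[OF step_on_Pair[OF assms], of fst]
    tensor_integral_comp[OF step_on_Pair[OF assms], of snd]
  by (simp add: tensor_add_right sum.distrib)

lemma tensor_integral_cong:
  assumes "\<And>x. x \<in> {p..<q} \<Longrightarrow> h x = k x"
  shows "tensor_integral p q h = tensor_integral p q k"
proof -
  have "h ` {p..<q} = k ` {p..<q}" using assms by (intro image_cong) auto
  moreover have "{x\<in>{p..<q}. h x = v} = {x\<in>{p..<q}. k x = v}" for v using assms by auto
  ultimately show ?thesis by (simp only: tensor_integral_def)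
qed

lemma tensor_integral_superset:
  assumes "finite V" "h ` {p..<q} \<subseteq> V"
  shows "tensor_integral p q h = (\<Sum>v\<in>V. tensor (measure lborel {x\<in>{p..<q}. h x = v}) v)"
  unfolding tensor_integral_def
proof (rule sum.mono_neutral_left[OF assms], intro ballI)
  fix v assume "v \<in> V - h ` {p..<q}"
  then have "{x\<in>{p..<q}. h x = v} = {}" by auto
  then show "tensor (measure lborel {x\<in>{p..<q}. h x = v}) v = 0"
    by (simp only: measure_empty tensor_zero_left)
qed

lemma IET_bij: "f \<in> IET p q \<Longrightarrow> bij_betw f {p..<q} {p..<q}"
  by (simp add: IET_def Bij_def)

lemma IET_displacement_step:
  assumes "f \<in> IET p q"
  shows "step_on p q (\<lambda>x. f x - x)"
proof -
  obtain k c t where P: "exchange_partition p q f k c t" using assms by (auto simp: IET_def)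
  have f: "f x - x = t i" if "i < k" "x \<in> {c i..<c (Suc i)}" for i x
    using P that by (auto simp: exchange_partition_def)
  have "(\<lambda>x. f x - x) ` {p..<q} \<subseteq> t ` {..<k}"
    using exchange_partition_ex[OF P] f by fastforce
  then have "finite ((\<lambda>x. f x - x) ` {p..<q})"
    by (rule finite_subset) simp
  moreover have "{x\<in>{p..<q}. f x - x = v} \<in> sets borel" for v
  proof -
    have "{x\<in>{p..<q}. f x - x = v} = (\<Union>i\<in>{i\<in>{..<k}. t i = v}. {c i..<c (Suc i)})"
    proof (intro equalityI subsetI)
      fix x assume x: "x \<in> {x\<in>{p..<q}. f x - x = v}"
      then obtain i where "i < k" "x \<in> {c i..<c (Suc i)}"
        using exchange_partition_ex[OF P] by blast
      with x f show "x \<in> (\<Union>i\<in>{i\<in>{..<k}. t i = v}. {c i..<c (Suc i)})" by auto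
    next
      fix x assume "x \<in> (\<Union>i\<in>{i\<in>{..<k}. t i = v}. {c i..<c (Suc i)})"
      then obtain i where "i < k" "t i = v" "x \<in> {c i..<c (Suc i)}" by blast
      then show "x \<in> {x\<in>{p..<q}. f x - x = v}"
        using f exchange_partition_sub[OF P] by blast
    qed
    then show ?thesis by simp
  qed
  ultimately show ?thesis unfolding step_on_def by blast
qed

text \<open>
  On each piece the preimage of \<open>S\<close> is a translate of a part of \<open>S\<close>; these parts are disjoint and
  cover \<open>S\<close>, because \<open>f\<close> is a bijection.
\<close>

lemma IET_measure_preserving:
  assumes f: "f \<in> IET p q" and S: "S \<in> sets borel" "S \<subseteq> {p..<q}"
  shows "{x\<in>{p..<q}. f x \<in> S} \<in> sets borel"
    and "measure lborel {x\<in>{p..<q}. f x \<in> S} = measure lborel S"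
proof -
  obtain k c t where P: "exchange_partition p q f k c t" using f by (auto simp: IET_def)
  have ft: "f x = x + t i" if "i < k" "x \<in> {c i..<c (Suc i)}" for i x
    using P that by (auto simp: exchange_partition_def)
  define A where "A i = {x\<in>{c i..<c (Suc i)}. t i + x \<in> S}" for i
  have A_meas: "A i \<in> sets borel" for i
  proof -
    have "(\<lambda>x. t i + x) -` S \<inter> space borel \<in> sets borel"
      by (rule measurable_sets[OF _ S(1)]) simp
    then have "{c i..<c (Suc i)} \<inter> ((\<lambda>x. t i + x) -` S \<inter> space borel) \<in> sets borel"
      by (intro sets.Int) auto
    moreover have "A i = {c i..<c (Suc i)} \<inter> ((\<lambda>x. t i + x) -` S \<inter> space borel)"
      by (auto simp: A_def)
    ultimately show ?thesis by simp
  qed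
  have A_f: "f x = t i + x" "x \<in> {p..<q}" if "i < k" "x \<in> A i" for i x
    using that ft exchange_partition_sub[OF P] by (auto simp: A_def subset_iff)
  have U: "{x\<in>{p..<q}. f x \<in> S} = (\<Union>i<k. A i)"
  proof (intro equalityI subsetI)
    fix x assume x: "x \<in> {x\<in>{p..<q}. f x \<in> S}"
    then obtain i where "i < k" "x \<in> {c i..<c (Suc i)}"
      using exchange_partition_ex[OF P] by blast
    with x ft show "x \<in> (\<Union>i<k. A i)" by (auto simp: A_def add.commute)
  next
    fix x assume "x \<in> (\<Union>i<k. A i)"
    then obtain i where i: "i < k" "x \<in> A i" by auto
    then show "x \<in> {x\<in>{p..<q}. f x \<in> S}"
      using A_f[OF i] by (auto simp: A_def)
  qed
  have disjA: "disjoint_family_on A {..<k}"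
    using exchange_partition_disj[OF P] by (fastforce simp: disjoint_family_on_def A_def)
  define B where "B i = (+) (t i) ` A i" for i
  have B_meas: "B i \<in> sets borel" for i
  proof -
    have "(\<lambda>x. - t i + x) -` A i \<inter> space borel \<in> sets borel"
      by (rule measurable_sets[OF _ A_meas]) simp
    moreover have "B i = (\<lambda>x. - t i + x) -` A i \<inter> space borel"
      by (auto simp: B_def intro!: image_eqI[of _ _ "_ - t i"])
    ultimately show ?thesis by simp
  qed
  have B_f: "B i = f ` A i" if "i < k" for i
    unfolding B_def by (intro image_cong refl) (simp add: A_f[OF that])
  have "S = f ` {x\<in>{p..<q}. f x \<in> S}"
  proof (intro equalityI subsetI)
    fix y assume y: "y \<in> S"
    then have "y \<in> f ` {p..<q}"
      using IET_bij[OF f] S(2) by (auto simp: bij_betw_def)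
    then show "y \<in> f ` {x\<in>{p..<q}. f x \<in> S}"
      using y by blast
  qed blast
  then have V: "S = (\<Union>i<k. B i)"
    unfolding U using B_f by auto
  have disjB: "disjoint_family_on B {..<k}"
    unfolding disjoint_family_on_def
  proof (intro ballI impI)
    fix i j assume ij: "i \<in> {..<k}" "j \<in> {..<k}" "i \<noteq> j"
    have "f ` A i \<inter> f ` A j = f ` (A i \<inter> A j)"
      using IET_bij[OF f] A_f ij
      by (intro inj_on_image_Int[symmetric, of f "{p..<q}"]) (auto simp: bij_betw_def)
    then show "B i \<inter> B j = {}"
      using disjA ij B_f by (auto simp: disjoint_family_on_def)
  qed
  have eA: "emeasure lborel (A i) \<noteq> \<infinity>" for i
    unfolding A_def by (rule emeasure_Collect_Ico_finite)
  have "B i = {x\<in>{c i + t i..<c (Suc i) + t i}. x \<in> S}" for i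
  proof -
    have "x \<in> B i" if "x \<in> {c i + t i..<c (Suc i) + t i}" "x \<in> S" for x
      unfolding B_def by (rule image_eqI[of _ _ "x - t i"]) (use that in \<open>auto simp: A_def\<close>)
    then show ?thesis by (auto simp: B_def A_def)
  qed
  then have eB: "emeasure lborel (B i) \<noteq> \<infinity>" for i
    by (simp only: emeasure_Collect_Ico_finite not_False_eq_True)
  have mAB: "measure lborel (B i) = measure lborel (A i)" for i
  proof -
    have "measure lborel (B i) = measure lebesgue (B i)"
      using B_meas by simp
    also have "\<dots> = measure lebesgue (A i)"
      unfolding B_def by (rule measure_translation)
    finally show ?thesis using A_meas by simp
  qed
  show "{x\<in>{p..<q}. f x \<in> S} \<in> sets borel"
    unfolding U using A_meas by auto
  have "measure lborel (\<Union>i<k. A i) = (\<Sum>i<k. measure lborel (A i))"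
    by (rule measure_finite_Union) (use A_meas disjA eA in auto)
  moreover have "measure lborel (\<Union>i<k. B i) = (\<Sum>i<k. measure lborel (B i))"
    by (rule measure_finite_Union) (use B_meas disjB eB in auto)
  ultimately show "measure lborel {x\<in>{p..<q}. f x \<in> S} = measure lborel S"
    unfolding U by (simp only: mAB flip: V)
qed

lemma
  assumes g: "g \<in> IET p q" and h: "step_on p q h"
  shows step_on_comp_IET: "step_on p q (\<lambda>x. h (g x))"
    and tensor_integral_comp_IET: "tensor_integral p q (\<lambda>x. h (g x)) = tensor_integral p q h"
proof -
  let ?I = "{p..<q}"
  have gI: "g ` ?I = ?I" using IET_bij[OF g] by (simp add: bij_betw_def)
  have img: "(\<lambda>x. h (g x)) ` ?I = h ` ?I"
    by (metis gI image_image)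
  have lev: "{x\<in>?I. h (g x) = v} = {x\<in>?I. g x \<in> {y\<in>?I. h y = v}}" for v
    using gI by auto
  have meas: "{y\<in>?I. h y = v} \<in> sets borel" for v
    using h by (simp add: step_on_def)
  have sub: "{y\<in>?I. h y = v} \<subseteq> ?I" for v by blast
  show "step_on p q (\<lambda>x. h (g x))"
    unfolding step_on_def
  proof (intro conjI allI)
    show "finite ((\<lambda>x. h (g x)) ` ?I)" unfolding img using h unfolding step_on_def by blast
    show "{x\<in>?I. h (g x) = v} \<in> sets borel" for v
      unfolding lev by (rule IET_measure_preserving(1)[OF g meas sub])
  qed
  show "tensor_integral p q (\<lambda>x. h (g x)) = tensor_integral p q h"
    unfolding tensor_integral_def lev img
    by (simp only: IET_measure_preserving(2)[OF g meas sub])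
qed

lemma SAF_eq_tensor_integral:
  assumes "f \<in> IET p q"
  shows "SAF p q f = tensor_integral p q (\<lambda>x. f x - x)"
proof -
  obtain k c t where P: "exchange_partition p q f k c t" using assms by (auto simp: IET_def)
  show ?thesis
    unfolding tensor_integral_def SAF_eq[OF P] by (rule exchange_sum_canonical[OF P])
qed

text \<open>
  The displacement of \<open>f \<circ> g\<close> at \<open>x\<close> is that of \<open>f\<close> at \<open>g x\<close> plus that of \<open>g\<close> at \<open>x\<close>.
\<close>

lemma SAF_compose:
  assumes f: "f \<in> IET p q" and g: "g \<in> IET p q"
  shows "SAF p q (compose {p..<q} f g) = SAF p q f + SAF p q g"
proof -
  let ?d = "\<lambda>f x. f x - x"
  note df = IET_displacement_step[OF f] and dg = IET_displacement_step[OF g]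
  have "SAF p q (compose {p..<q} f g) = tensor_integral p q (?d (compose {p..<q} f g))"
    by (intro SAF_eq_tensor_integral IET_compose f g)
  also have "\<dots> = tensor_integral p q (\<lambda>x. ?d f (g x) + ?d g x)"
    by (rule tensor_integral_cong) (simp add: compose_def)
  also have "\<dots> = tensor_integral p q (?d f) + tensor_integral p q (?d g)"
    unfolding tensor_integral_add[OF step_on_comp_IET[OF g df] dg] tensor_integral_comp_IET[OF g df] ..
  finally show ?thesis by (simp only: SAF_eq_tensor_integral f g)
qed


section \<open>The invariant as a homomorphism\<close>

lemma carrier_IET_group [simp]: "carrier (IET_group p q) = IET p q"
  by (simp add: IET_group_def)

lemma one_IET_group: "\<one>\<^bsub>IET_group p q\<^esub> = (\<lambda>x\<in>{p..<q}. x)"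
  by (simp add: IET_group_def BijGroup_def)

lemma mult_IET_group:
  "f \<in> IET p q \<Longrightarrow> g \<in> IET p q \<Longrightarrow> f \<otimes>\<^bsub>IET_group p q\<^esub> g = compose {p..<q} f g"
  by (simp add: IET_group_def BijGroup_def IET_def)

lemma SAF_mult:
  "f \<in> IET p q \<Longrightarrow> g \<in> IET p q \<Longrightarrow> SAF p q (f \<otimes>\<^bsub>IET_group p q\<^esub> g) = SAF p q f + SAF p q g"
  by (simp add: mult_IET_group SAF_compose)

lemma SAF_one: "p \<le> q \<Longrightarrow> SAF p q \<one>\<^bsub>IET_group p q\<^esub> = 0"
proof -
  assume "p \<le> q"
  then interpret group "IET_group p q" by (rule group_IET_group)
  have "\<one>\<^bsub>IET_group p q\<^esub> \<in> IET p q" using one_closed by simp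
  from SAF_mult[OF this this] show ?thesis using one_closed by simp
qed

lemma SAF_inv:
  assumes "p \<le> q" "f \<in> IET p q"
  shows "SAF p q (inv\<^bsub>IET_group p q\<^esub> f) = - SAF p q f"
proof -
  interpret group "IET_group p q" using assms(1) by (rule group_IET_group)
  have "inv\<^bsub>IET_group p q\<^esub> f \<in> IET p q" using inv_closed assms(2) by simp
  then have "SAF p q (inv\<^bsub>IET_group p q\<^esub> f) + SAF p q f = SAF p q \<one>\<^bsub>IET_group p q\<^esub>"
    using SAF_mult[of "inv\<^bsub>IET_group p q\<^esub> f" p q f] assms(2) by simp
  then show ?thesis by (simp add: SAF_one assms(1) eq_neg_iff_add_eq_0)
qed

lemma SAF_pow:
  assumes "p \<le> q" "f \<in> IET p q"
  shows "SAF p q (f [^]\<^bsub>IET_group p q\<^esub> (n::nat)) = (\<Sum>j<n. SAF p q f)"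
proof (induction n)
  case 0
  interpret group "IET_group p q" using assms(1) by (rule group_IET_group)
  show ?case by (simp add: SAF_one assms(1))
next
  case (Suc n)
  interpret group "IET_group p q" using assms(1) by (rule group_IET_group)
  show ?case using Suc nat_pow_closed[of f n] assms(2) by (simp add: SAF_mult)
qed

lemma SAF_kernel_subgroup:
  assumes "p \<le> q"
  shows "subgroup {f \<in> carrier (IET_group p q). SAF p q f = 0} (IET_group p q)"
proof -
  interpret group "IET_group p q" using assms(1) by (rule group_IET_group)
  show ?thesis
  proof (rule subgroupI)
    show "{f \<in> carrier (IET_group p q). SAF p q f = 0} \<noteq> {}"
      using SAF_one[OF assms] one_closed by blast
  qed (use assms inv_closed m_closed in \<open>auto simp: SAF_inv SAF_mult\<close>)
qed

lemma SAF_finite_order: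
  assumes "p < q" "f \<in> IET p q" "group.ord (IET_group p q) f \<noteq> 0"
  shows "SAF p q f = 0"
proof -
  interpret group "IET_group p q" using assms(1) by (intro group_IET_group) simp
  obtain k c t where P: "exchange_partition p q f k c t" using assms(2) by (auto simp: IET_def)
  have "(\<Sum>j<ord f. SAF p q f) = SAF p q (f [^]\<^bsub>IET_group p q\<^esub> ord f)"
    using assms(1,2) by (intro SAF_pow[symmetric]) auto
  also have "\<dots> = 0"
    using assms(1,2) by (simp add: SAF_one)
  finally have "(\<Sum>j<ord f. SAF p q f) = 0" .
  then show ?thesis
    unfolding SAF_eq[OF P] using assms(3) by (intro tensor_torsion_free) auto
qed

lemma SAF_commutator:
  assumes "p \<le> q" "f \<in> IET p q" "g \<in> IET p q"
  defines "G \<equiv> IET_group p q"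
  shows "SAF p q (f \<otimes>\<^bsub>G\<^esub> g \<otimes>\<^bsub>G\<^esub> inv\<^bsub>G\<^esub> f \<otimes>\<^bsub>G\<^esub> inv\<^bsub>G\<^esub> g) = 0"
proof -
  interpret group "IET_group p q" using assms(1) by (rule group_IET_group)
  show ?thesis
    unfolding G_def using assms m_closed[simplified] inv_closed[simplified]
    by (simp add: SAF_mult SAF_inv)
qed


section \<open>Integrally independent lengths\<close>

text \<open>
  Sums are taken over lists, which later become the lists of lengths of consecutive intervals.
\<close>

definition nat_span :: "real set \<Rightarrow> real set" where
  "nat_span L = {sum_list ls | ls. set ls \<subseteq> L}"

lemma nat_span_base: "x \<in> L \<Longrightarrow> x \<in> nat_span L"
  unfolding nat_span_def by (rule CollectI, rule exI[of _ "[x]"]) simp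

lemma nat_span_add: "x \<in> nat_span L \<Longrightarrow> y \<in> nat_span L \<Longrightarrow> x + y \<in> nat_span L"
  unfolding nat_span_def
proof clarify
  fix us vs assume "set us \<subseteq> L" "set vs \<subseteq> L"
  then show "\<exists>ls. sum_list us + sum_list vs = sum_list ls \<and> set ls \<subseteq> L"
    by (intro exI[of _ "us @ vs"]) simp
qed

lemma nat_span_mult: "x \<in> L \<Longrightarrow> real n * x \<in> nat_span L"
  unfolding nat_span_def
  by (rule CollectI, rule exI[of _ "replicate n x"]) (auto simp: sum_list_replicate)

lemma nat_span_trans:
  assumes "L \<subseteq> nat_span M" "x \<in> nat_span L"
  shows "x \<in> nat_span M"
proof -
  have "set ls \<subseteq> L \<Longrightarrow> sum_list ls \<in> nat_span M" for ls
  proof (induction ls)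
    case Nil
    show ?case unfolding nat_span_def by (rule CollectI, rule exI[of _ "[]"]) simp
  next
    case (Cons l ls)
    then show ?case using assms(1) by (auto intro: nat_span_add)
  qed
  then show ?thesis using assms(2) by (auto simp: nat_span_def)
qed

text \<open>
  For finite \<open>L\<close>, clearing denominators makes this the same as linear independence over the rationals.
\<close>

definition int_independent :: "real set \<Rightarrow> bool" where
  "int_independent L \<longleftrightarrow>
     (\<forall>r :: real \<Rightarrow> int. (\<Sum>l\<in>L. of_int (r l) * l) = 0 \<longrightarrow> (\<forall>l\<in>L. r l = 0))"

text \<open>
  A Euclidean algorithm. In a nontrivial relation between positive numbers there are terms of both
  signs. If \<open>a\<close> and \<open>b\<close> carry opposite signs and \<open>\<bar>r b\<bar> b \<le> \<bar>r a\<bar> a\<close>, then \<open>b\<close> is absorbed: replace \<open>a\<close>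
  by \<open>a' = a - (\<bar>r b\<bar> / \<bar>r a\<bar>) b\<close> and \<open>b\<close> by \<open>b' = b / \<bar>r a\<bar>\<close>. Both old numbers are natural combinations
  of the new ones, and in the new relation \<open>b'\<close> has coefficient \<open>0\<close>, so there are fewer nonzero terms.
  The process can only end with \<open>a' = 0\<close> or with a coincidence among the new numbers, and both make
  the set smaller.
\<close>

lemma nat_span_smaller_generators:
  fixes r :: "real \<Rightarrow> int"
  assumes "finite L" "\<forall>l\<in>L. 0 < l" "(\<Sum>l\<in>L. of_int (r l) * l) = 0" "\<exists>l\<in>L. r l \<noteq> 0"
  shows "\<exists>M. finite M \<and> (\<forall>l\<in>M. 0 < l) \<and> card M < card L \<and> L \<subseteq> nat_span M"
  using assms
proof (induction "card {l\<in>L. r l \<noteq> 0}" arbitrary: L r rule: less_induct)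
  case less
  note fin = less.prems(1) and pos = less.prems(2) and rel = less.prems(3)
  have ex_pos: "\<exists>l\<in>L. 0 < s l"
    if "(\<Sum>l\<in>L. of_int (s l) * l) = 0" "\<exists>l\<in>L. s l \<noteq> 0" for s :: "real \<Rightarrow> int"
  proof (rule ccontr)
    assume "\<not> ?thesis"
    then have *: "s l \<le> 0" if "l \<in> L" for l using that by (meson not_less)
    have "(\<Sum>l\<in>L. of_int (- s l) * l) = 0" using that(1) by (simp add: sum_negf)
    moreover have "\<forall>l\<in>L. 0 \<le> of_int (- s l) * l"
      using * pos by (auto intro!: mult_nonpos_nonneg simp: less_imp_le)
    ultimately have "\<forall>l\<in>L. of_int (- s l) * l = 0"
      using fin by (subst (asm) sum_nonneg_eq_0_iff) auto
    then show False using that(2) pos by fastforce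
  qed
  obtain a0 b0 where ab0: "a0 \<in> L" "b0 \<in> L" "0 < r a0" "r b0 < 0"
    using ex_pos[of r] ex_pos[of "\<lambda>l. - r l"] less.prems by (auto simp: sum_negf)
  \<comment> \<open>The roles of \<open>a0\<close> and \<open>b0\<close> are chosen so that \<open>a'\<close> below is nonnegative.\<close>
  obtain a b where ab: "a \<in> L" "b \<in> L" "r a \<noteq> 0" "r b \<noteq> 0" "a \<noteq> b"
      "of_int \<bar>r b\<bar> * b \<le> of_int \<bar>r a\<bar> * a"
      and sgn: "real_of_int (r b) * real_of_int \<bar>r a\<bar> = - real_of_int (r a) * real_of_int \<bar>r b\<bar>"
  proof (cases "of_int \<bar>r b0\<bar> * b0 \<le> of_int \<bar>r a0\<bar> * a0")
    case True
    show ?thesis by (rule that[of a0 b0]) (use ab0 True in auto)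
  next
    case False
    show ?thesis by (rule that[of b0 a0]) (use ab0 False in auto)
  qed
  define a' where "a' = a - of_int \<bar>r b\<bar> / of_int \<bar>r a\<bar> * b"
  define b' where "b' = b / of_int \<bar>r a\<bar>"
  have ra: "real_of_int \<bar>r a\<bar> > 0" using ab by simp
  have a: "a = a' + real (nat \<bar>r b\<bar>) * b'"
    by (simp add: a'_def b'_def)
  have b: "b = real (nat \<bar>r a\<bar>) * b'"
    using ra by (simp add: b'_def)
  have b'_pos: "0 < b'" using ra pos ab by (simp add: b'_def)
  have a'_nonneg: "0 \<le> a'" using ra ab by (simp add: a'_def field_simps)
  define K where "K = L - {a, b}"
  have K: "finite K" "a \<notin> K" "b \<notin> K" "L = insert a (insert b K)" "\<forall>l\<in>K. 0 < l"
    using fin ab pos by (auto simp: K_def)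
  have card_L: "card L = Suc (Suc (card K))" using K ab by simp
  have sub: "L \<subseteq> nat_span M" if "insert b' K \<subseteq> M" "a' = 0 \<or> a' \<in> M" for M
  proof -
    have "b \<in> nat_span M" using that nat_span_mult[of b' M "nat \<bar>r a\<bar>"] by (subst b) auto
    moreover have m: "real (nat \<bar>r b\<bar>) * b' \<in> nat_span M" using that by (intro nat_span_mult) auto
    moreover have "a \<in> nat_span M"
      using that(2) m nat_span_add[OF nat_span_base m, of a'] by (subst a) auto
    moreover have "K \<subseteq> nat_span M" using that nat_span_base by blast
    ultimately show ?thesis using K(4) by blast
  qed
  show ?case
  proof (cases "a' = 0")
    case True
    have "card (insert b' K) < card L" using K(1) card_L by (simp add: card_insert_if)
    then show ?thesis
      using K sub[of "insert b' K"] b'_pos True by (intro exI[of _ "insert b' K"]) auto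
  next
    case False
    then have a'_pos: "0 < a'" using a'_nonneg by simp
    let ?M = "insert a' (insert b' K)"
    have M: "finite ?M" "\<forall>l\<in>?M. 0 < l" "L \<subseteq> nat_span ?M"
      using K(1,5) b'_pos a'_pos sub[of ?M] by blast+
    show ?thesis
    proof (cases "card ?M < card L")
      case True
      then show ?thesis using M by blast
    next
      case False
      have new: "a' \<notin> insert b' K" "b' \<notin> K"
        using False K(1) card_L by (auto simp: card_insert_if split: if_splits)
      have card_M: "card ?M = card L" using new K(1) card_L by simp
      define s where "s l = (if l = a' then r a else if l = b' then 0 else r l)" for l
      have sK: "s l = r l" if "l \<in> K" for l using that new by (auto simp: s_def)
      have "(\<Sum>l\<in>?M. of_int (s l) * l) = of_int (r a) * a' + (\<Sum>l\<in>K. of_int (r l) * l)"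
        using new K(1) sK by (auto simp: s_def[of a'] s_def[of b'])
      also have "of_int (r a) * a' = of_int (r a) * a + of_int (r b) * b"
        using ra sgn by (simp add: a'_def field_simps)
      also have "\<dots> + (\<Sum>l\<in>K. of_int (r l) * l) = (\<Sum>l\<in>L. of_int (r l) * l)"
        using K ab by simp
      finally have rel': "(\<Sum>l\<in>?M. of_int (s l) * l) = 0" using rel by simp
      have "{l\<in>?M. s l \<noteq> 0} = insert a' {l\<in>K. r l \<noteq> 0}"
        using new ab sK by (auto simp: s_def[of a'] s_def[of b'])
      moreover have "{l\<in>L. r l \<noteq> 0} = insert a (insert b {l\<in>K. r l \<noteq> 0})"
        using K ab by auto
      ultimately have "card {l\<in>?M. s l \<noteq> 0} < card {l\<in>L. r l \<noteq> 0}"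
        using new K ab by simp
      moreover have "\<exists>l\<in>?M. s l \<noteq> 0" using ab by (auto simp: s_def)
      ultimately have "\<exists>M'. finite M' \<and> (\<forall>l\<in>M'. 0 < l) \<and> card M' < card ?M \<and> ?M \<subseteq> nat_span M'"
        by (intro less.hyps[of ?M s] M rel')
      then obtain M' where M': "finite M'" "\<forall>l\<in>M'. 0 < l" "card M' < card L" "?M \<subseteq> nat_span M'"
        unfolding card_M by blast
      have "L \<subseteq> nat_span M'"
        using M(3) nat_span_trans[OF M'(4)] by blast
      then show ?thesis using M'(1-3) by blast
    qed
  qed
qed

text \<open>
  A generating set of least cardinality is independent, since a relation would give a smaller one.
\<close>

lemma nat_span_independent_generators:
  assumes "finite \<Lambda>" "\<forall>l\<in>\<Lambda>. 0 < l"
  obtains L where "finite L" "\<forall>l\<in>L. 0 < l" "int_independent L" "\<Lambda> \<subseteq> nat_span L"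
proof -
  let ?P = "\<lambda>L. finite L \<and> (\<forall>l\<in>L. 0 < l) \<and> \<Lambda> \<subseteq> nat_span L"
  have "?P \<Lambda>" using assms nat_span_base by blast
  then obtain L where L: "?P L" and min: "\<And>M. ?P M \<Longrightarrow> card L \<le> card M"
    using ex_has_least_nat[of ?P \<Lambda> card] by blast
  have "int_independent L"
    unfolding int_independent_def
  proof (intro allI impI, rule ccontr)
    fix r :: "real \<Rightarrow> int"
    assume "(\<Sum>l\<in>L. of_int (r l) * l) = 0" "\<not> (\<forall>l\<in>L. r l = 0)"
    then obtain M where M: "finite M" "\<forall>l\<in>M. 0 < l" "card M < card L" "L \<subseteq> nat_span M"
      using nat_span_smaller_generators[of L r] L by blast
    have "\<Lambda> \<subseteq> nat_span M" using L nat_span_trans[OF M(4)] by blast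
    then have "?P M" using M(1,2) by blast
    then show False using min M(3) by fastforce
  qed
  then show ?thesis using that L by blast
qed

text \<open>
  Dividing all generators by a large natural number keeps them independent, and their natural
  combinations still include the original generators.
\<close>

lemma nat_span_small_independent_generators:
  assumes "finite \<Lambda>" "\<forall>l\<in>\<Lambda>. 0 < l" "0 < e"
  obtains L where "finite L" "\<forall>l\<in>L. 0 < l \<and> l < e" "int_independent L" "\<Lambda> \<subseteq> nat_span L"
proof -
  obtain L where L: "finite L" "\<forall>l\<in>L. 0 < l" "int_independent L" "\<Lambda> \<subseteq> nat_span L"
    using nat_span_independent_generators[OF assms(1,2)] by blast
  obtain m where m: "real m > sum id L / e" using reals_Archimedean2 by blast
  have "0 \<le> sum id L" using L(2) by (intro sum_nonneg) (auto simp: less_imp_le)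
  then have "0 \<le> sum id L / e" using assms(3) by simp
  then have m0: "0 < real m" using m by linarith
  let ?d = "\<lambda>l. l / real m"
  have small: "?d l < e" if "l \<in> L" for l
  proof -
    have "l \<le> sum id L" using that L member_le_sum[of l L id] by (auto simp: less_imp_le)
    also have "sum id L < e * real m" using m assms(3) by (simp add: field_simps)
    finally show ?thesis using m0 by (simp add: field_simps)
  qed
  have inj: "inj_on ?d L" using m0 by (auto simp: inj_on_def)
  have "L \<subseteq> nat_span (?d ` L)"
  proof
    fix l assume "l \<in> L"
    then have "real m * ?d l \<in> nat_span (?d ` L)" by (intro nat_span_mult) auto
    then show "l \<in> nat_span (?d ` L)" using m0 by simp
  qed
  then have "\<Lambda> \<subseteq> nat_span (?d ` L)" using L(4) nat_span_trans[of L "?d ` L"] by blast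
  moreover have "int_independent (?d ` L)"
    unfolding int_independent_def
  proof (intro allI impI)
    fix r :: "real \<Rightarrow> int" assume "(\<Sum>l\<in>?d ` L. of_int (r l) * l) = 0"
    then have "(\<Sum>l\<in>L. of_int (r (?d l)) * l) / real m = 0"
      by (subst (asm) sum.reindex[OF inj]) (simp add: sum_divide_distrib)
    then have "(\<Sum>l\<in>L. of_int ((r \<circ> ?d) l) * l) = 0" using m0 by simp
    then have "\<forall>l\<in>L. (r \<circ> ?d) l = 0" using L(3) unfolding int_independent_def by blast
    then show "\<forall>l\<in>?d ` L. r l = 0" by simp
  qed
  ultimately show ?thesis using that[of "?d ` L"] L small m0 by auto
qed

lemma common_denominator:
  fixes u :: "'a \<Rightarrow> rat"
  assumes "finite t"
  obtains D :: int where "D > 0" "\<forall>v\<in>t. of_int D * u v \<in> \<int>"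
proof -
  have "\<exists>D::int. D > 0 \<and> (\<forall>v\<in>t. of_int D * u v \<in> \<int>)"
    using assms
  proof induction
    case empty
    show ?case by (rule exI[of _ 1]) simp
  next
    case (insert x F)
    then obtain D :: int where D: "D > 0" "\<forall>v\<in>F. of_int D * u v \<in> \<int>" by blast
    obtain n d where nd: "u x = of_int n / of_int d" "d > 0"
      using quotient_of_div[of "u x"] quotient_of_denom_pos[of "u x"] by (metis surj_pair)
    have "of_int (D * d) * u x = of_int (D * n)" using nd by simp
    then have "of_int (D * d) * u x \<in> \<int>" using Ints_of_int by metis
    moreover have "of_int (D * d) * u v \<in> \<int>" if "v \<in> F" for v
    proof -
      have "of_int d * (of_int D * u v) \<in> \<int>"
        using D(2) that by (intro Ints_mult[of "of_int d" "of_int D * u v"] Ints_of_int) blast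
      then show ?thesis by (simp add: mult_ac)
    qed
    moreover have "D * d > 0" using D(1) nd(2) by simp
    ultimately show ?case by blast
  qed
  then show ?thesis using that by blast
qed

text \<open>
  The coordinate at \<open>a\<close> of a basis of \<open>\<real>\<close> over the rationals that extends \<open>L\<close>.
\<close>

lemma dual_functional:
  assumes "int_independent L" "finite L"
  obtains \<alpha> :: "real \<Rightarrow> real"
  where "\<And>x y. \<alpha> (x + y) = \<alpha> x + \<alpha> y" "\<And>r x. \<alpha> (of_rat r * x) = of_rat r * \<alpha> x"
    "\<And>l. l \<in> L \<Longrightarrow> \<alpha> l = (if l = a then 1 else 0)"
proof -
  let ?s = "\<lambda>(r::rat) (x::real). of_rat r * x"
  interpret vector_space_pair ?s ?s
    by unfold_locales (auto simp: algebra_simps of_rat_add of_rat_mult)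
  have "vs1.independent L"
    unfolding vs1.independent_explicit_module
  proof (intro allI impI)
    fix t u v assume t: "finite t" "t \<subseteq> L" "(\<Sum>v\<in>t. of_rat (u v) * v) = 0" "v \<in> t"
    obtain D :: int where D: "D > 0" "\<forall>v\<in>t. of_int D * u v \<in> \<int>"
      using common_denominator[OF t(1), of u] .
    define r where "r v = (if v \<in> t then \<lfloor>of_int D * u v\<rfloor> else 0)" for v
    have r: "real_of_int (r v) = of_int D * of_rat (u v)" if "v \<in> t" for v
    proof -
      have "of_int (r v) = of_int D * u v" using D(2) that by (simp add: r_def)
      then have "of_rat (of_int (r v)) = (of_rat (of_int D * u v) :: real)" by simp
      then show ?thesis by (simp add: of_rat_mult)
    qed
    have "(\<Sum>l\<in>L. of_int (r l) * l) = (\<Sum>l\<in>t. of_int (r l) * l)"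
      using t(2) assms(2) by (intro sum.mono_neutral_right) (auto simp: r_def)
    also have "\<dots> = of_int D * (\<Sum>l\<in>t. of_rat (u l) * l)"
      by (simp add: r sum_distrib_left mult.assoc)
    finally have "(\<Sum>l\<in>L. of_int (r l) * l) = 0" using t(3) by simp
    then have "r v = 0" using assms(1) t(2,4) unfolding int_independent_def by blast
    then show "u v = 0" using r[OF t(4)] D(1) by simp
  qed
  then obtain \<alpha> where \<alpha>: "Vector_Spaces.linear ?s ?s \<alpha>" "\<forall>l\<in>L. \<alpha> l = (if l = a then 1 else 0)"
    using linear_independent_extend[of L "\<lambda>l. if l = a then 1 else 0"] by blast
  interpret \<alpha>: Vector_Spaces.linear ?s ?s \<alpha> by (rule \<alpha>(1))
  show ?thesis
    by (rule that[of \<alpha>]) (simp_all add: \<alpha>.add \<alpha>.scale \<alpha>(2))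
qed


section \<open>Exchanges of adjacent intervals and swaps of equal intervals\<close>

definition adjacent_exchange :: "real \<Rightarrow> real \<Rightarrow> real \<Rightarrow> real \<Rightarrow> real" where
  "adjacent_exchange x a b z =
     (if x \<le> z \<and> z < x + a then z + b
      else if x + a \<le> z \<and> z < x + a + b then z - a
      else z)"

definition interval_swap :: "real \<Rightarrow> real \<Rightarrow> real \<Rightarrow> real \<Rightarrow> real" where
  "interval_swap x y w z =
     (if x \<le> z \<and> z < x + w then z + (y - x)
      else if y \<le> z \<and> z < y + w then z - (y - x)
      else z)"

lemma adjacent_exchange_inverse:
  "0 < a \<Longrightarrow> 0 < b \<Longrightarrow> adjacent_exchange x b a (adjacent_exchange x a b z) = z"
  by (auto simp: adjacent_exchange_def)

lemma interval_swap_involution: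
  "0 < w \<Longrightarrow> x + w \<le> y \<Longrightarrow> interval_swap x y w (interval_swap x y w z) = z"
  by (auto simp: interval_swap_def)

lemma adjacent_exchange_same: "adjacent_exchange x a a = interval_swap x (x + a) a"
  by (auto simp: adjacent_exchange_def interval_swap_def fun_eq_iff)

lemma adjacent_exchange_commute:
  assumes "0 < a" "0 < b" "0 < c" "0 < d" "x + a + b \<le> y"
  shows "adjacent_exchange x a b (adjacent_exchange y c d z) =
    adjacent_exchange y c d (adjacent_exchange x a b z)"
  using assms by (auto simp: adjacent_exchange_def)

text \<open>
  This is why the location of an adjacent exchange does not matter modulo the swaps.
\<close>

lemma interval_swap_conjugate:
  assumes "0 < a" "0 < b" "x + a + b \<le> y"
  shows "interval_swap x y (a + b) (adjacent_exchange x a b (interval_swap x y (a + b) z)) =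
    adjacent_exchange y a b z"
  using assms by (auto simp: adjacent_exchange_def interval_swap_def)

text \<open>
  Here \<open>s\<close> swaps the left halves of the two intervals, and \<open>c\<close> swaps the two halves within each of
  them. So \<open>c s c\<close> swaps the right halves, and the full swap is \<open>s (c s c)\<close>, a commutator because
  \<open>s\<close> and \<open>c\<close> are involutions.
\<close>

lemma interval_swap_halves:
  fixes x y v z :: real
  assumes "0 < v" "x + 2 * v \<le> y"
  defines "s \<equiv> interval_swap x y v" and "c \<equiv> \<lambda>z. interval_swap x (x + v) v (interval_swap y (y + v) v z)"
  shows "interval_swap x y (2 * v) z = s (c (s (c z)))"
proof -
  consider "z < x" | "x \<le> z" "z < x + v" | "x + v \<le> z" "z < x + 2 * v" | "x + 2 * v \<le> z" "z < y"
    | "y \<le> z" "z < y + v" | "y + v \<le> z" "z < y + 2 * v" | "y + 2 * v \<le> z"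
    by linarith
  then show ?thesis
    unfolding s_def c_def by cases (use assms(1,2) in \<open>simp_all add: interval_swap_def\<close>)
qed

lemma interval_swap_halves_involution:
  fixes x y v z :: real
  assumes "0 < v" "x + 2 * v \<le> y"
  defines "c \<equiv> \<lambda>z. interval_swap x (x + v) v (interval_swap y (y + v) v z)"
  shows "c (c z) = z"
proof -
  consider "z < x" | "x \<le> z" "z < x + v" | "x + v \<le> z" "z < x + 2 * v" | "x + 2 * v \<le> z" "z < y"
    | "y \<le> z" "z < y + v" | "y + v \<le> z" "z < y + 2 * v" | "y + 2 * v \<le> z"
    by linarith
  then show ?thesis
    unfolding c_def by cases (use assms(1,2) in \<open>simp_all add: interval_swap_def\<close>)
qed

lemma restrict_mult_IET_group:
  assumes "restrict f {p..<q} \<in> IET p q" "restrict g {p..<q} \<in> IET p q"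
  shows "restrict f {p..<q} \<otimes>\<^bsub>IET_group p q\<^esub> restrict g {p..<q} = restrict (\<lambda>z. f (g z)) {p..<q}"
proof -
  have "g z \<in> {p..<q}" if "z \<in> {p..<q}" for z
    using assms(2) that by (fastforce simp: IET_def Bij_def bij_betw_def)
  then show ?thesis
    unfolding mult_IET_group[OF assms] by (auto simp: compose_def restrict_def fun_eq_iff)
qed

lemma restrict_in_IET:
  assumes "p \<le> q" "finite A"
    and step: "\<And>x y. x \<in> {p..<q} \<Longrightarrow> y \<in> {p..<q} \<Longrightarrow> x \<le> y \<Longrightarrow> A \<inter> {x<..y} = {} \<Longrightarrow>
      f y - y = f x - x"
    and inv: "\<And>x. x \<in> {p..<q} \<Longrightarrow> f x \<in> {p..<q} \<and> g x \<in> {p..<q} \<and> g (f x) = x \<and> f (g x) = x"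
  shows "restrict f {p..<q} \<in> IET p q"
proof -
  have "bij_betw f {p..<q} {p..<q}"
    by (rule bij_betw_byWitness[of _ g]) (use inv in auto)
  then have "restrict f {p..<q} \<in> Bij {p..<q}"
    by (simp add: Bij_def bij_betw_cong[of _ "restrict f {p..<q}" f])
  moreover have "\<forall>x\<in>{p..<q}. \<forall>y\<in>{p..<q}. x \<le> y \<longrightarrow> A \<inter> {x<..y} = {} \<longrightarrow>
      restrict f {p..<q} y - y = restrict f {p..<q} x - x"
    using step by simp
  ultimately show ?thesis
    unfolding IET_def exchange_partition_breaks using assms(1,2) by blast
qed

lemma adjacent_exchange_in_IET:
  assumes "0 < a" "0 < b" "p \<le> x" "x + a + b \<le> q"
  shows "restrict (adjacent_exchange x a b) {p..<q} \<in> IET p q"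
proof (rule restrict_in_IET[of p q "{x, x + a, x + a + b}" _ "adjacent_exchange x b a"])
  fix u v assume uv: "u \<le> v" "{x, x + a, x + a + b} \<inter> {u<..v} = {}"
  then have "\<not> (u < x \<and> x \<le> v)" "\<not> (u < x + a \<and> x + a \<le> v)" "\<not> (u < x + a + b \<and> x + a + b \<le> v)"
    by auto
  then show "adjacent_exchange x a b v - v = adjacent_exchange x a b u - u"
    using uv(1) assms by (auto simp: adjacent_exchange_def)
next
  fix z assume "z \<in> {p..<q}"
  then show "adjacent_exchange x a b z \<in> {p..<q} \<and> adjacent_exchange x b a z \<in> {p..<q} \<and>
      adjacent_exchange x b a (adjacent_exchange x a b z) = z \<and>
      adjacent_exchange x a b (adjacent_exchange x b a z) = z"
    using assms by (auto simp: adjacent_exchange_def)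
qed (use assms in auto)

lemma interval_swap_in_IET:
  assumes "0 < w" "p \<le> x" "x + w \<le> y" "y + w \<le> q"
  shows "restrict (interval_swap x y w) {p..<q} \<in> IET p q"
proof (rule restrict_in_IET[of p q "{x, x + w, y, y + w}" _ "interval_swap x y w"])
  fix u v assume uv: "u \<le> v" "{x, x + w, y, y + w} \<inter> {u<..v} = {}"
  then have "\<not> (u < x \<and> x \<le> v)" "\<not> (u < x + w \<and> x + w \<le> v)"
    "\<not> (u < y \<and> y \<le> v)" "\<not> (u < y + w \<and> y + w \<le> v)"
    by auto
  then show "interval_swap x y w v - v = interval_swap x y w u - u"
    using uv(1) assms by (auto simp: interval_swap_def)
next
  fix z assume "z \<in> {p..<q}"
  then show "interval_swap x y w z \<in> {p..<q} \<and> interval_swap x y w z \<in> {p..<q} \<and>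
      interval_swap x y w (interval_swap x y w z) = z \<and> interval_swap x y w (interval_swap x y w z) = z"
    using assms by (auto simp: interval_swap_def)
qed (use assms in auto)

lemma adjacent_exchange_mult_inverse:
  assumes "0 < a" "0 < b" "p \<le> x" "x + a + b \<le> q"
  shows "restrict (adjacent_exchange x b a) {p..<q} \<otimes>\<^bsub>IET_group p q\<^esub>
    restrict (adjacent_exchange x a b) {p..<q} = \<one>\<^bsub>IET_group p q\<^esub>"
  using assms by (subst restrict_mult_IET_group)
    (auto intro!: adjacent_exchange_in_IET simp: adjacent_exchange_inverse one_IET_group)

lemma interval_swap_mult_self:
  assumes "0 < w" "p \<le> x" "x + w \<le> y" "y + w \<le> q"
  shows "restrict (interval_swap x y w) {p..<q} \<otimes>\<^bsub>IET_group p q\<^esub>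
    restrict (interval_swap x y w) {p..<q} = \<one>\<^bsub>IET_group p q\<^esub>"
  using assms by (subst restrict_mult_IET_group)
    (auto intro!: interval_swap_in_IET simp: interval_swap_involution one_IET_group)

lemma ord_interval_swap:
  assumes "0 < w" "p \<le> x" "x + w \<le> y" "y + w \<le> q"
  shows "group.ord (IET_group p q) (restrict (interval_swap x y w) {p..<q}) = 2"
proof -
  interpret group "IET_group p q" by (rule group_IET_group) (use assms in linarith)
  let ?s = "restrict (interval_swap x y w) {p..<q}"
  have s: "?s \<in> carrier (IET_group p q)" using interval_swap_in_IET[OF assms] by simp
  have "?s [^]\<^bsub>IET_group p q\<^esub> (2::nat) = \<one>\<^bsub>IET_group p q\<^esub>"
    using interval_swap_mult_self[OF assms] s by (simp add: numeral_2_eq_2)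
  then have "ord ?s dvd 2" using s pow_eq_id by blast
  moreover have "?s \<noteq> \<one>\<^bsub>IET_group p q\<^esub>"
  proof
    assume "?s = \<one>\<^bsub>IET_group p q\<^esub>"
    then have "?s x = (\<lambda>z\<in>{p..<q}. z) x" by (simp add: one_IET_group)
    then show False using assms by (simp add: interval_swap_def)
  qed
  then have "ord ?s \<noteq> 1" using ord_eq_1[OF s] by blast
  ultimately show ?thesis
    using prime_nat_iff two_is_prime_nat by blast
qed

lemma interval_swap_in_derived:
  assumes "0 < w" "p \<le> x" "x + w \<le> y" "y + w \<le> q"
  shows "restrict (interval_swap x y w) {p..<q} \<in> derived (IET_group p q) (carrier (IET_group p q))"
proof -
  let ?G = "IET_group p q"
  interpret group ?G by (rule group_IET_group) (use assms in linarith)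
  define v where "v = w / 2"
  have w: "w = 2 * v" by (simp add: v_def)
  let ?s = "restrict (interval_swap x y v) {p..<q}"
  let ?c = "restrict (\<lambda>z. interval_swap x (x + v) v (interval_swap y (y + v) v z)) {p..<q}"
  have s: "?s \<in> IET p q" by (rule interval_swap_in_IET) (use assms w in auto)
  have cc: "restrict (interval_swap x (x + v) v) {p..<q} \<in> IET p q"
    "restrict (interval_swap y (y + v) v) {p..<q} \<in> IET p q"
    by (rule interval_swap_in_IET; use assms w in auto)+
  have c: "?c \<in> IET p q"
    using m_closed[of "restrict (interval_swap x (x + v) v) {p..<q}"
        "restrict (interval_swap y (y + v) v) {p..<q}"] cc
    by (simp add: restrict_mult_IET_group)
  have "?s \<otimes>\<^bsub>?G\<^esub> ?s = \<one>\<^bsub>?G\<^esub>"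
    by (rule interval_swap_mult_self) (use assms w in auto)
  then have inv_s: "inv\<^bsub>?G\<^esub> ?s = ?s" using s by (simp add: inv_equality)
  have "?c \<otimes>\<^bsub>?G\<^esub> ?c = \<one>\<^bsub>?G\<^esub>"
    unfolding restrict_mult_IET_group[OF c c] one_IET_group
    using interval_swap_halves_involution[of v x y] assms w by simp
  then have inv_c: "inv\<^bsub>?G\<^esub> ?c = ?c" using c by (simp add: inv_equality)
  have sc: "?s \<otimes>\<^bsub>?G\<^esub> ?c \<in> IET p q" using m_closed s c by simp
  note sc' = sc[unfolded restrict_mult_IET_group[OF s c]]
  have "restrict (interval_swap x y w) {p..<q} = (?s \<otimes>\<^bsub>?G\<^esub> ?c) \<otimes>\<^bsub>?G\<^esub> (?s \<otimes>\<^bsub>?G\<^esub> ?c)"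
    unfolding restrict_mult_IET_group[OF s c] restrict_mult_IET_group[OF sc' sc'] w
    by (intro restrict_ext interval_swap_halves) (use assms w in auto)
  also have "\<dots> = ?s \<otimes>\<^bsub>?G\<^esub> ?c \<otimes>\<^bsub>?G\<^esub> inv\<^bsub>?G\<^esub> ?s \<otimes>\<^bsub>?G\<^esub> inv\<^bsub>?G\<^esub> ?c"
    unfolding inv_s inv_c using s c by (simp add: m_assoc m_closed[simplified])
  also have "\<dots> \<in> derived ?G (carrier ?G)"
    unfolding derived_def using s c by (intro generate.incl) auto
  finally show ?thesis .
qed

lemma SAF_adjacent_exchange:
  assumes "0 < a" "0 < b" "p \<le> x" "x + a + b \<le> q"
  shows "SAF p q (restrict (adjacent_exchange x a b) {p..<q}) = tensor a b - tensor b a"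
proof -
  let ?I = "{p..<q}" and ?d = "\<lambda>z. adjacent_exchange x a b z - z"
  have lev: "{z\<in>?I. ?d z = b} = {x..<x + a}" "{z\<in>?I. ?d z = - a} = {x + a..<x + a + b}"
    using assms by (auto simp: adjacent_exchange_def)
  have "SAF p q (restrict (adjacent_exchange x a b) ?I) =
      tensor_integral p q (\<lambda>z. restrict (adjacent_exchange x a b) ?I z - z)"
    by (rule SAF_eq_tensor_integral[OF adjacent_exchange_in_IET[OF assms]])
  also have "\<dots> = tensor_integral p q ?d"
    by (rule tensor_integral_cong) simp
  also have "\<dots> = (\<Sum>v\<in>{b, - a, 0}. tensor (measure lborel {z\<in>?I. ?d z = v}) v)"
    by (rule tensor_integral_superset) (auto simp: adjacent_exchange_def)
  also have "\<dots> = tensor (measure lborel {z\<in>?I. ?d z = b}) b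
      + tensor (measure lborel {z\<in>?I. ?d z = - a}) (- a) + tensor (measure lborel {z\<in>?I. ?d z = 0}) 0"
    using assms by (simp add: add.assoc del: diff_eq_eq right_minus_eq)
  also have "\<dots> = tensor a b - tensor b a"
    unfolding lev using assms tensor_add_right[of _ 0 0] by (simp add: tensor_uminus_right)
  finally show ?thesis .
qed


section \<open>Adjacent exchanges generate\<close>

text \<open>
  Consecutive intervals with lengths \<open>ls\<close>, the first of which starts at \<open>r\<close>, on each of which \<open>f\<close> is a
  translation. The list form makes cutting and transposing pieces operations on lists.
\<close>

fun translation_pieces :: "(real \<Rightarrow> real) \<Rightarrow> real \<Rightarrow> real list \<Rightarrow> bool" where
  "translation_pieces f r [] \<longleftrightarrow> True"
| "translation_pieces f r (l # ls) \<longleftrightarrow>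
     0 < l \<and> (\<exists>t. \<forall>z. r \<le> z \<longrightarrow> z < r + l \<longrightarrow> f z = z + t) \<and> translation_pieces f (r + l) ls"

lemma translation_pieces_append:
  "translation_pieces f r (us @ vs) \<longleftrightarrow>
    translation_pieces f r us \<and> translation_pieces f (r + sum_list us) vs"
  by (induction us arbitrary: r) (auto simp: add.assoc)

lemma translation_pieces_sum_nonneg: "translation_pieces f r ls \<Longrightarrow> 0 \<le> sum_list ls"
  by (induction ls arbitrary: r) (auto simp: add_nonneg_nonneg less_imp_le)

lemma translation_pieces_cong:
  assumes "translation_pieces f r ls" "\<And>z. r \<le> z \<Longrightarrow> z < r + sum_list ls \<Longrightarrow> g z = f z"
  shows "translation_pieces g r ls"
  using assms
proof (induction ls arbitrary: r)
  case (Cons l ls)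
  then obtain t where t: "0 < l" "\<And>z. r \<le> z \<Longrightarrow> z < r + l \<Longrightarrow> f z = z + t" "translation_pieces f (r + l) ls"
    by auto
  have "0 \<le> sum_list ls" using translation_pieces_sum_nonneg[OF t(3)] .
  then have "\<forall>z. r \<le> z \<longrightarrow> z < r + l \<longrightarrow> g z = z + t"
    using Cons.prems(2) t(2) by simp
  moreover have "translation_pieces g (r + l) ls"
    by (rule Cons.IH[OF t(3)]) (use Cons.prems(2) t(1) in simp)
  ultimately show ?case using t(1) by auto
qed simp

lemma translation_pieces_single:
  assumes "\<forall>l\<in>set ls. 0 < l" "\<And>z. r \<le> z \<Longrightarrow> z < r + sum_list ls \<Longrightarrow> f z = z + t"
  shows "translation_pieces f r ls"
  using assms
proof (induction ls arbitrary: r)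
  case (Cons l ls)
  have "0 \<le> sum_list ls" using Cons.prems(1) by (intro sum_list_nonneg) (auto simp: less_imp_le)
  then have "\<forall>z. r \<le> z \<longrightarrow> z < r + l \<longrightarrow> f z = z + t"
    using Cons.prems(2) by simp
  moreover have "translation_pieces f (r + l) ls"
    by (rule Cons.IH) (use Cons.prems in simp_all)
  ultimately show ?case using Cons.prems(1) by auto
qed simp

text \<open>
  Each piece is cut into pieces whose lengths are the summands of its length.
\<close>

lemma translation_pieces_refine:
  assumes "translation_pieces f r ls" "set ls \<subseteq> nat_span L" "\<forall>l\<in>L. 0 < l"
  shows "\<exists>ms. set ms \<subseteq> L \<and> translation_pieces f r ms \<and> sum_list ms = sum_list ls"
  using assms(1,2)
proof (induction ls arbitrary: r)
  case Nil
  show ?case by (rule exI[of _ "[]"]) simp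
next
  case (Cons l ls)
  obtain t where t: "0 < l" "\<And>z. r \<le> z \<Longrightarrow> z < r + l \<Longrightarrow> f z = z + t" "translation_pieces f (r + l) ls"
    using Cons.prems by auto
  obtain ms where ms: "set ms \<subseteq> L" "translation_pieces f (r + l) ms" "sum_list ms = sum_list ls"
    using Cons.IH[OF t(3)] Cons.prems by auto
  obtain ns where ns: "set ns \<subseteq> L" "sum_list ns = l"
    using Cons.prems(2) by (auto simp: nat_span_def)
  have "translation_pieces f r ns"
    by (rule translation_pieces_single[of _ _ _ t]) (use ns assms(3) t(2) in auto)
  then show ?case
    using ms ns by (intro exI[of _ "ns @ ms"]) (auto simp: translation_pieces_append)
qed

lemma exchange_partition_pieces:
  assumes "exchange_partition p q f k c t"
  shows "\<exists>ls. translation_pieces f p ls \<and> p + sum_list ls = q"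
proof -
  have "j \<le> k \<Longrightarrow> \<exists>ls. translation_pieces f p ls \<and> p + sum_list ls = c j" for j
  proof (induction j)
    case 0
    show ?case by (rule exI[of _ "[]"]) (use assms in \<open>simp add: exchange_partition_def\<close>)
  next
    case (Suc j)
    then obtain ls where ls: "translation_pieces f p ls" "p + sum_list ls = c j" by auto
    have "c j < c (Suc j)" "\<And>z. c j \<le> z \<Longrightarrow> z < c (Suc j) \<Longrightarrow> f z = z + t j"
      using assms Suc.prems by (auto simp: exchange_partition_def)
    then have "translation_pieces f p (ls @ [c (Suc j) - c j]) \<and> p + sum_list (ls @ [c (Suc j) - c j]) = c (Suc j)"
      using ls by (auto simp: translation_pieces_append)
    then show ?case by blast
  qed
  from this[of k] show ?thesis using assms by (simp add: exchange_partition_def)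
qed

lemma translation_pieces_split:
  assumes "translation_pieces f r ls" "r \<le> x" "x < r + sum_list ls"
  shows "\<exists>us l vs. ls = us @ l # vs \<and> r + sum_list us \<le> x \<and> x < r + sum_list us + l"
  using assms
proof (induction ls arbitrary: r)
  case (Cons l ls)
  show ?case
  proof (cases "x < r + l")
    case True
    then show ?thesis using Cons.prems by (intro exI[of _ "[]"]) auto
  next
    case False
    then obtain us m vs where "ls = us @ m # vs" "r + l + sum_list us \<le> x" "x < r + l + sum_list us + m"
      using Cons.IH[of "r + l"] Cons.prems by auto
    then show ?thesis by (intro exI[of _ "l # us"] exI[of _ m] exI[of _ vs]) auto
  qed
qed simp

definition adjacent_exchanges :: "real \<Rightarrow> real \<Rightarrow> real set \<Rightarrow> (real \<Rightarrow> real) set" where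
  "adjacent_exchanges p q L =
     {restrict (adjacent_exchange x a b) {p..<q} | x a b.
        a \<in> L \<and> b \<in> L \<and> p \<le> x \<and> x + a + b \<le> q}"

text \<open>
  Sorting by adjacent transpositions. Suppose \<open>f\<close> is the identity on \<open>[p, r)\<close>. Some piece of \<open>f\<close> is
  mapped to the interval that starts at \<open>r\<close>. Precomposing with adjacent exchanges moves this piece to
  the left past its predecessors until it is the first one; then \<open>f\<close> fixes it pointwise and there
  are fewer pieces left to sort. The outer induction is on the number of pieces, the inner one on
  the list of predecessors.
\<close>

lemma IET_generated_by_adjacent_exchanges:
  assumes pq: "p < q" and L: "\<forall>l\<in>L. 0 < l"
    and f: "f \<in> IET p q" "translation_pieces f r ls" "set ls \<subseteq> L" "r + sum_list ls = q" "p \<le> r"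
      "\<forall>z\<in>{p..<r}. f z = z"
  shows "f \<in> generate (IET_group p q) (adjacent_exchanges p q L)"
  using f
proof (induction "length ls" arbitrary: f r ls rule: less_induct)
  case less
  let ?G = "IET_group p q" and ?I = "{p..<q}"
  let ?H = "generate ?G (adjacent_exchanges p q L)"
  interpret group ?G by (rule group_IET_group) (use pq in simp)
  note fI = less.prems(1) and fp = less.prems(2) and len = less.prems(4)
    and pr = less.prems(5) and fix_f = less.prems(6)
  have bijf: "bij_betw f ?I ?I" by (rule IET_bij[OF fI])
  show ?case
  proof (cases "ls = []")
    case True
    then have "f z = z" if "z \<in> ?I" for z using len that fix_f by simp
    moreover have "f \<in> extensional ?I" using fI by (auto simp: IET_def Bij_def)
    ultimately have "f = \<one>\<^bsub>?G\<^esub>"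
      unfolding one_IET_group by (intro ext) (auto simp: extensional_def)
    then show ?thesis by (simp add: generate.one)
  next
    case False
    then have "0 < sum_list ls"
      using fp by (cases ls) (auto intro!: add_pos_nonneg dest: translation_pieces_sum_nonneg)
    then have r: "r \<in> ?I" using pr len by auto
    then obtain x where x: "x \<in> ?I" "f x = r"
      using bijf unfolding bij_betw_def by (metis imageE)
    have "r \<le> x"
    proof (rule ccontr)
      assume "\<not> r \<le> x"
      then have "f x = x" using fix_f x(1) by simp
      then show False using x(2) \<open>\<not> r \<le> x\<close> by simp
    qed
    moreover have "x < r + sum_list ls" using x(1) len by simp
    ultimately obtain us l vs where ls: "ls = us @ l # vs"
      and x_in: "r + sum_list us \<le> x" "x < r + sum_list us + l"
      using translation_pieces_split[OF fp] by blast
    let ?y = "r + sum_list us"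
    obtain t where t: "\<And>z. ?y \<le> z \<Longrightarrow> z < ?y + l \<Longrightarrow> f z = z + t"
      and us: "translation_pieces f r us"
      using fp unfolding ls translation_pieces_append by auto
    have y: "r \<le> ?y" "?y \<in> ?I"
      using translation_pieces_sum_nonneg[OF us] pr x(1) x_in by auto
    \<comment> \<open>No point of the piece can be mapped into \<open>[p, r)\<close>, which \<open>f\<close> fixes; so \<open>x\<close> is its left end.\<close>
    have "f ?y = r"
    proof (rule antisym)
      show "f ?y \<le> r" using t[of x] t[of ?y] x_in x(2) by simp
      show "r \<le> f ?y"
      proof (rule ccontr)
        assume *: "\<not> r \<le> f ?y"
        have fy: "f ?y \<in> ?I" using bijf y(2) by (auto simp: bij_betw_def)
        then have "f (f ?y) = f ?y" using fix_f * by simp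
        then have "f ?y = ?y" using bijf y(2) fy by (auto simp: bij_betw_def dest: inj_onD)
        then show False using * y(1) by simp
      qed
    qed
    moreover have "g \<in> ?H"
      if "g \<in> IET p q" "\<forall>z\<in>{p..<r}. g z = z" "translation_pieces g r (ws @ l # vs)" "set (ws @ l # vs) \<subseteq> L"
        "r + sum_list (ws @ l # vs) = q" "length (ws @ l # vs) = length ls" "g (r + sum_list ws) = r"
      for g ws vs
      using that
    proof (induction ws arbitrary: g vs rule: rev_induct)
      case Nil
      obtain t where "0 < l" and t: "\<And>z. r \<le> z \<Longrightarrow> z < r + l \<Longrightarrow> g z = z + t"
        and vs: "translation_pieces g (r + l) vs"
        using Nil.prems(3) by auto
      then have "t = 0" using Nil.prems(7) t[of r] by simp
      show ?case
      proof (rule less.hyps[OF _ Nil.prems(1) vs])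
        show "\<forall>z\<in>{p..<r + l}. g z = z" using Nil.prems(2) t \<open>t = 0\<close> by auto
      qed (use Nil.prems pr \<open>0 < l\<close> in auto)
    next
      case (snoc m ws)
      let ?y = "r + sum_list ws"
      have ws: "translation_pieces g r ws" and rest: "translation_pieces g ?y (m # l # vs)"
        using snoc.prems(3) by (simp_all add: translation_pieces_append)
      obtain s where m: "0 < m" and s: "\<And>z. ?y \<le> z \<Longrightarrow> z < ?y + m \<Longrightarrow> g z = z + s"
        using rest by auto
      obtain t where l: "0 < l" and t: "\<And>z. ?y + m \<le> z \<Longrightarrow> z < ?y + m + l \<Longrightarrow> g z = z + t"
        and vs: "translation_pieces g (?y + m + l) vs"
        using rest by auto
      have ry: "r \<le> ?y" using translation_pieces_sum_nonneg[OF ws] by simp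
      have yq: "?y + m + l + sum_list vs = q" using snoc.prems(5) by simp
      have yq': "?y + m + l \<le> q" using yq translation_pieces_sum_nonneg[OF vs] by simp
      have mL: "m \<in> L" "l \<in> L" using snoc.prems(4) by auto
      let ?R = "restrict (adjacent_exchange ?y l m) ?I" and ?R' = "restrict (adjacent_exchange ?y m l) ?I"
      have R: "?R \<in> IET p q" "?R' \<in> IET p q"
        using m l pr ry yq' by (auto intro!: adjacent_exchange_in_IET)
      \<comment> \<open>The lengths of \<open>h\<close> are those of \<open>g\<close> with \<open>m\<close> and \<open>l\<close> transposed.\<close>
      define h where "h = g \<otimes>\<^bsub>?G\<^esub> ?R"
      have hI: "h \<in> IET p q" using m_closed[simplified] snoc.prems(1) R by (simp add: h_def)
      have h: "h z = g (adjacent_exchange ?y l m z)" if "p \<le> z" "z < q" for z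
        using snoc.prems(1) R that by (simp add: h_def mult_IET_group compose_def)
      have h_left: "h z = g z" if "p \<le> z" "z < ?y" for z
        using h[of z] that yq' m l by (simp add: adjacent_exchange_def)
      have h_right: "h z = g z" if "?y + m + l \<le> z" "z < q" for z
        using h[of z] that m l pr ry by (simp add: adjacent_exchange_def)
      have h_l: "h z = z + (m + t)" if "?y \<le> z" "z < ?y + l" for z
        using h[of z] that m l pr ry yq' t[of "z + m"] by (simp add: adjacent_exchange_def)
      have h_m: "h z = z + (s - l)" if "?y + l \<le> z" "z < ?y + l + m" for z
        using h[of z] that m l pr ry yq' s[of "z - l"] by (simp add: adjacent_exchange_def)
      have "h \<in> ?H"
      proof (rule snoc.IH[of h "m # vs"])
        show "\<forall>z\<in>{p..<r}. h z = z" using snoc.prems(2) h_left ry by simp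
        have "translation_pieces h r ws" by (rule translation_pieces_cong[OF ws]) (use h_left pr in simp)
        moreover have "translation_pieces h (?y + m + l) vs"
          by (rule translation_pieces_cong[OF vs]) (use h_right yq in simp)
        then have "translation_pieces h (?y + l + m) vs" by (simp add: algebra_simps)
        ultimately show "translation_pieces h r (ws @ l # m # vs)"
          using m l h_l h_m by (auto simp: translation_pieces_append)
        show "h (r + sum_list ws) = r"
          using h_l[of ?y] l t[of "?y + m"] snoc.prems(7) by (simp add: add.assoc)
      qed (use hI snoc.prems in auto)
      moreover have "?R' \<in> ?H"
        unfolding adjacent_exchanges_def
        by (intro generate.incl CollectI exI[of _ ?y] exI[of _ m] exI[of _ l]) (use mL pr ry yq' in auto)
      ultimately have "h \<otimes>\<^bsub>?G\<^esub> ?R' \<in> ?H" by (rule generate.eng)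
      also have "h \<otimes>\<^bsub>?G\<^esub> ?R' = g \<otimes>\<^bsub>?G\<^esub> (?R \<otimes>\<^bsub>?G\<^esub> ?R')"
        unfolding h_def using snoc.prems(1) R by (simp add: m_assoc)
      also have "?R \<otimes>\<^bsub>?G\<^esub> ?R' = \<one>\<^bsub>?G\<^esub>"
        using m l pr ry yq' by (intro adjacent_exchange_mult_inverse) auto
      finally show ?case using snoc.prems(1) by simp
    qed
    ultimately show ?thesis
      using less.prems ls by blast
  qed
qed


section \<open>Cancelling products of commuting factors\<close>

text \<open>
  The factors commute with each other, but the ambient group is not assumed to be abelian, so the
  product is taken along a list.
\<close>

definition (in monoid) list_mult :: "('c \<Rightarrow> 'a) \<Rightarrow> 'c list \<Rightarrow> 'a" where
  "list_mult \<phi> zs = foldr (\<lambda>z x. \<phi> z \<otimes> x) zs \<one>"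

lemma (in monoid) list_mult_simps [simp]:
  "list_mult \<phi> [] = \<one>" "list_mult \<phi> (z # zs) = \<phi> z \<otimes> list_mult \<phi> zs"
  by (simp_all add: list_mult_def)

lemma (in monoid) list_mult_closed [simp]:
  "\<phi> ` set zs \<subseteq> carrier G \<Longrightarrow> list_mult \<phi> zs \<in> carrier G"
  by (induction zs) auto

lemma (in monoid) list_mult_append:
  "\<phi> ` set us \<subseteq> carrier G \<Longrightarrow> \<phi> ` set vs \<subseteq> carrier G \<Longrightarrow>
    list_mult \<phi> (us @ vs) = list_mult \<phi> us \<otimes> list_mult \<phi> vs"
  by (induction us) (auto simp: m_assoc)

lemma (in monoid) list_mult_pull:
  assumes "\<phi> ` set (us @ z # vs) \<subseteq> carrier G" "\<And>u. u \<in> set us \<Longrightarrow> \<phi> u \<otimes> \<phi> z = \<phi> z \<otimes> \<phi> u"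
  shows "list_mult \<phi> (us @ z # vs) = \<phi> z \<otimes> list_mult \<phi> (us @ vs)"
  using assms
proof (induction us)
  case (Cons u us)
  then have c: "\<phi> u \<in> carrier G" "\<phi> z \<in> carrier G" "list_mult \<phi> (us @ vs) \<in> carrier G"
    by (auto intro!: list_mult_closed)
  have "list_mult \<phi> ((u # us) @ z # vs) = \<phi> u \<otimes> (\<phi> z \<otimes> list_mult \<phi> (us @ vs))"
    using Cons by simp
  also have "\<dots> = \<phi> z \<otimes> (\<phi> u \<otimes> list_mult \<phi> (us @ vs))"
    using c Cons.prems(2)[of u] by (simp flip: m_assoc)
  finally show ?case by simp
qed simp

text \<open>
  The first factor \<open>\<phi> (a, b)\<close> is trivial if \<open>a = b\<close>; otherwise \<open>\<phi> (b, a)\<close> occurs later on, can be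
  moved next to it, and cancels it. What remains is balanced again.
\<close>

lemma (in group) list_mult_balanced:
  assumes "\<phi> ` set zs \<subseteq> carrier G"
    and "\<And>z w. z \<in> set zs \<Longrightarrow> w \<in> set zs \<Longrightarrow> \<phi> z \<otimes> \<phi> w = \<phi> w \<otimes> \<phi> z"
    and "\<And>a. (a, a) \<in> set zs \<Longrightarrow> \<phi> (a, a) = \<one>"
    and "\<And>a b. (a, b) \<in> set zs \<Longrightarrow> (b, a) \<in> set zs \<Longrightarrow> \<phi> (a, b) \<otimes> \<phi> (b, a) = \<one>"
    and "\<And>a b. a \<noteq> b \<Longrightarrow> count_list zs (a, b) = count_list zs (b, a)"
  shows "list_mult \<phi> zs = \<one>"
  using assms
proof (induction "length zs" arbitrary: zs rule: less_induct)
  case less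
  show ?case
  proof (cases zs)
    case (Cons z ws)
    obtain a b where z: "z = (a, b)" by (cases z)
    show ?thesis
    proof (cases "a = b")
      case True
      have "count_list ws (c, d) = count_list ws (d, c)" if "c \<noteq> d" for c d
        using less.prems(5)[OF that] that True unfolding Cons z by (auto split: if_splits)
      then have "list_mult \<phi> ws = \<one>"
        using less.prems(1-4) unfolding Cons by (intro less.hyps) (auto simp: Cons)
      then show ?thesis using less.prems(3)[of a] unfolding Cons z True by simp
    next
      case False
      have "count_list ws (b, a) > 0"
        using less.prems(5)[OF False] False unfolding Cons z by auto
      then have "(b, a) \<in> set ws"
        by (metis count_list_0_iff less_irrefl)
      then obtain us vs where ws: "ws = us @ (b, a) # vs"
        by (meson split_list)
      have "list_mult \<phi> (us @ vs) = \<one>"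
      proof (rule less.hyps)
        show "count_list (us @ vs) (c, d) = count_list (us @ vs) (d, c)" if "c \<noteq> d" for c d
          using less.prems(5)[OF that] that False unfolding Cons z ws by (auto split: if_splits)
      qed (use less.prems(1-4) in \<open>auto simp: Cons ws\<close>)
      moreover have "list_mult \<phi> ws = \<phi> (b, a) \<otimes> list_mult \<phi> (us @ vs)"
        unfolding ws using less.prems(1,2) by (intro list_mult_pull) (auto simp: Cons ws)
      ultimately show ?thesis
        using less.prems(1,4) unfolding Cons z by (simp add: ws)
    qed
  qed simp
qed


section \<open>The kernel of the invariant\<close>

text \<open>
  Apply the functional \<open>x \<otimes> y \<mapsto> \<alpha> x \<beta> y\<close>, where \<open>\<alpha>\<close> and \<open>\<beta>\<close> are the coordinates at \<open>a\<close> and \<open>b\<close>: it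
  sends \<open>c \<otimes> d - d \<otimes> c\<close> to \<open>1\<close> if \<open>(c, d) = (a, b)\<close>, to \<open>-1\<close> if \<open>(c, d) = (b, a)\<close>, and to \<open>0\<close> for all
  other \<open>c, d \<in> L\<close>.
\<close>

lemma tensor_wedge_counts:
  assumes L: "finite L" "int_independent L" and zs: "set zs \<subseteq> L \<times> L"
    and 0: "(\<Sum>(c, d)\<leftarrow>zs. tensor c d - tensor d c) = 0" and "a \<noteq> b"
  shows "count_list zs (a, b) = count_list zs (b, a)"
proof (cases "a \<in> L \<and> b \<in> L")
  case False
  then have "(a, b) \<notin> set zs" "(b, a) \<notin> set zs" using zs by auto
  then show ?thesis using count_notin by metis
next
  case True
  obtain \<alpha> where \<alpha>: "\<And>x y. \<alpha> (x + y) = \<alpha> x + \<alpha> y" "\<And>r x. \<alpha> (of_rat r * x) = of_rat r * \<alpha> x"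
    "\<And>l. l \<in> L \<Longrightarrow> \<alpha> l = (if l = a then 1 else (0::real))"
    using dual_functional[OF L(2,1)] by metis
  obtain \<beta> where \<beta>: "\<And>x y. \<beta> (x + y) = \<beta> x + \<beta> y" "\<And>r x. \<beta> (of_rat r * x) = of_rat r * \<beta> x"
    "\<And>l. l \<in> L \<Longrightarrow> \<beta> l = (if l = b then 1 else (0::real))"
    using dual_functional[OF L(2,1)] by metis
  let ?\<gamma> = "\<lambda>x y. \<alpha> x * \<beta> y"
  have "?\<gamma> (x + x') y = ?\<gamma> x y + ?\<gamma> x' y" "?\<gamma> x (y + y') = ?\<gamma> x y + ?\<gamma> x y'"
    "?\<gamma> (of_rat r * x) y = ?\<gamma> x (of_rat r * y)" for x x' y y' r
    by (simp_all only: \<alpha>(1,2) \<beta>(1,2) distrib_left distrib_right mult.assoc mult.left_commute)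
  then obtain ev where ev: "\<And>u v. ev (u + v) = ev u + ev v" "\<And>u v. ev (u - v) = ev u - ev v"
    "\<And>x y. ev (tensor x y) = \<alpha> x * \<beta> y"
    using tensor_functional[of ?\<gamma>] by metis
  have ev0: "ev 0 = 0" using ev(1)[of 0 0] by simp
  have "ev (\<Sum>(c, d)\<leftarrow>zs. tensor c d - tensor d c)
      = real (count_list zs (a, b)) - real (count_list zs (b, a))"
    using zs
  proof (induction zs)
    case (Cons z zs)
    obtain c d where z: "z = (c, d)" by (cases z)
    then have "c \<in> L" "d \<in> L" using Cons.prems by auto
    then show ?case
      using Cons \<open>a \<noteq> b\<close> by (auto simp: z ev \<alpha>(3) \<beta>(3))
  qed (simp add: ev0)
  then show ?thesis using 0 ev0 by simp
qed

text \<open>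
  In the quotient by \<open>N\<close> the adjacent exchanges with small lengths are determined by their types and
  commute; there \<open>f\<close> becomes a product in which, by the vanishing of its invariant, every type
  \<open>(a, b)\<close> is balanced by \<open>(b, a)\<close>.
\<close>

lemma SAF_kernel_subset_normal:
  assumes pq: "p < q" and N: "N \<lhd> IET_group p q"
    and swap_N: "\<And>x y w. 0 < w \<Longrightarrow> p \<le> x \<Longrightarrow> x + w \<le> y \<Longrightarrow> y + w \<le> q \<Longrightarrow>
      restrict (interval_swap x y w) {p..<q} \<in> N"
    and f: "f \<in> IET p q" "SAF p q f = 0"
  shows "f \<in> N"
proof -
  let ?I = "{p..<q}"
  define G where "G = IET_group p q"
  interpret group G unfolding G_def by (rule group_IET_group) (use pq in simp)
  interpret N: normal N G using N by (simp add: G_def)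
  define Q where "Q = G Mod N"
  interpret Q: group Q unfolding Q_def by (rule N.factorgroup_is_group)
  have car [simp]: "carrier G = IET p q" by (simp add: G_def)
  define cls where "cls g = N #>\<^bsub>G\<^esub> g" for g
  have cls_hom: "cls \<in> hom G Q"
    unfolding cls_def Q_def by (rule N.r_coset_hom_Mod)
  have cls_closed: "cls g \<in> carrier Q" if "g \<in> IET p q" for g
    using hom_in_carrier[OF cls_hom] that by simp
  have cls_mult: "cls (g \<otimes>\<^bsub>G\<^esub> h) = cls g \<otimes>\<^bsub>Q\<^esub> cls h" if "g \<in> IET p q" "h \<in> IET p q" for g h
    using hom_mult[OF cls_hom] that by simp
  have cls_N: "cls g = \<one>\<^bsub>Q\<^esub>" if "g \<in> N" for g
    using that by (simp add: cls_def Q_def N.rcos_const)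
  have N_cls: "g \<in> N" if "cls g = \<one>\<^bsub>Q\<^esub>" "g \<in> IET p q" for g
    using that rcos_self[OF _ N.subgroup_axioms, of g] by (simp add: cls_def Q_def)
  have cls_one: "cls \<one>\<^bsub>G\<^esub> = \<one>\<^bsub>Q\<^esub>" by (rule cls_N) simp
  let ?R = "\<lambda>x a b. restrict (adjacent_exchange x a b) ?I"
  have disjoint: "cls (?R y a b) = cls (?R x a b)"
    if "0 < a" "0 < b" "p \<le> x" "x + a + b \<le> y" "y + a + b \<le> q" for a b x y
  proof -
    let ?S = "restrict (interval_swap x y (a + b)) ?I"
    have S: "?S \<in> N" using that by (intro swap_N) auto
    have R: "?R x a b \<in> IET p q" using that by (intro adjacent_exchange_in_IET) auto
    have S': "?S \<in> IET p q" using that by (intro interval_swap_in_IET) auto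
    have SR: "?S \<otimes>\<^bsub>G\<^esub> ?R x a b \<in> IET p q" using m_closed S' R by simp
    have "?S \<otimes>\<^bsub>G\<^esub> ?R x a b \<otimes>\<^bsub>G\<^esub> ?S = ?R y a b"
      using SR unfolding G_def restrict_mult_IET_group[OF S' R]
      using interval_swap_conjugate[of a b x y] that S'
      by (simp add: restrict_mult_IET_group)
    then have "cls (?R y a b) = cls (?S \<otimes>\<^bsub>G\<^esub> ?R x a b \<otimes>\<^bsub>G\<^esub> ?S)" by simp
    also have "\<dots> = cls (?R x a b)"
      using S' R SR cls_closed by (simp add: cls_mult cls_N[OF S])
    finally show ?thesis .
  qed
  \<comment> \<open>If \<open>x\<close> is too close to \<open>p\<close> for a direct swap, both locations are compared with the right end
      of the interval, which is disjoint from both because \<open>a + b\<close> is at most a quarter of \<open>q - p\<close>.\<close>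
  have same: "cls (?R x a b) = cls (?R p a b)"
    if "0 < a" "0 < b" "p \<le> x" "x + a + b \<le> q" "4 * (a + b) \<le> q - p" for a b x
  proof (cases "x < p + a + b")
    case True
    have "cls (?R (q - a - b) a b) = cls (?R x a b)" "cls (?R (q - a - b) a b) = cls (?R p a b)"
      by (rule disjoint; use that True in auto)+
    then show ?thesis by simp
  qed (use that disjoint in auto)
  \<comment> \<open>Any four lengths below \<open>e\<close> fit side by side, and any two add up to at most a quarter.\<close>
  define e where "e = (q - p) / 8"
  obtain k c t where "exchange_partition p q f k c t"
    using f(1) by (auto simp: IET_def)
  then obtain ks where ks: "translation_pieces f p ks" "p + sum_list ks = q"
    using exchange_partition_pieces by blast
  have "\<forall>l\<in>set ks. 0 < l"
  proof -
    have "translation_pieces f r ls \<Longrightarrow> \<forall>l\<in>set ls. 0 < l" for r ls by (induction ls arbitrary: r) auto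
    then show ?thesis using ks(1) by blast
  qed
  then obtain L where L: "finite L" "\<forall>l\<in>L. 0 < l \<and> l < e" "int_independent L" "set ks \<subseteq> nat_span L"
    using nat_span_small_independent_generators[of "set ks" e] pq by (auto simp: e_def)
  then have Lpos: "\<forall>l\<in>L. 0 < l" by blast
  obtain ls where ls: "set ls \<subseteq> L" "translation_pieces f p ls" "sum_list ls = sum_list ks"
    using translation_pieces_refine[OF ks(1) L(4) Lpos] by blast
  have "f \<in> generate G (adjacent_exchanges p q L)"
    unfolding G_def by (rule IET_generated_by_adjacent_exchanges[OF pq Lpos f(1) ls(2,1)]) (use ls ks in auto)
  define \<phi> where "\<phi> = (\<lambda>(a, b). cls (?R p a b))"
  have small: "0 < a" "0 < b" "p + a + b + c + d \<le> q" "4 * (a + b) \<le> q - p"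
    if "a \<in> L" "b \<in> L" "c \<in> L" "d \<in> L" for a b c d
  proof -
    have "0 < l \<and> 8 * l < q - p" if "l \<in> L" for l
      using L(2) that by (auto simp: e_def)
    from this[of a] this[of b] this[of c] this[of d]
    show "0 < a" "0 < b" "p + a + b + c + d \<le> q" "4 * (a + b) \<le> q - p"
      using that by auto
  qed
  have R_IET: "?R x a b \<in> IET p q" if "a \<in> L" "b \<in> L" "p \<le> x" "x + a + b \<le> q" for x a b
    using that Lpos by (intro adjacent_exchange_in_IET) auto
  have \<phi>_closed: "\<phi> ` (L \<times> L) \<subseteq> carrier Q"
  proof clarify
    fix a b assume "a \<in> L" "b \<in> L"
    then show "\<phi> (a, b) \<in> carrier Q"
      using small[of a b a b] by (auto simp: \<phi>_def intro!: cls_closed R_IET)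
  qed
  have \<phi>_comm: "\<phi> z \<otimes>\<^bsub>Q\<^esub> \<phi> w = \<phi> w \<otimes>\<^bsub>Q\<^esub> \<phi> z" if "z \<in> L \<times> L" "w \<in> L \<times> L" for z w
  proof -
    obtain a b c d where z: "z = (a, b)" "w = (c, d)" and in_L: "a \<in> L" "b \<in> L" "c \<in> L" "d \<in> L"
      using \<open>z \<in> L \<times> L\<close> \<open>w \<in> L \<times> L\<close> by blast
    note sm = small[OF in_L] small[OF in_L(3,4,1,2)]
    have R: "?R p a b \<in> IET p q" "?R (p + a + b) c d \<in> IET p q"
      using in_L sm by (auto intro!: R_IET)
    \<comment> \<open>Moved next to the first exchange, the second one has disjoint support.\<close>
    have "?R p a b \<otimes>\<^bsub>G\<^esub> ?R (p + a + b) c d = ?R (p + a + b) c d \<otimes>\<^bsub>G\<^esub> ?R p a b"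
      unfolding G_def restrict_mult_IET_group[OF R] restrict_mult_IET_group[OF R(2,1)]
      using sm by (intro restrict_ext adjacent_exchange_commute) auto
    then have "cls (?R p a b) \<otimes>\<^bsub>Q\<^esub> cls (?R (p + a + b) c d)
        = cls (?R (p + a + b) c d) \<otimes>\<^bsub>Q\<^esub> cls (?R p a b)"
      using R by (simp flip: cls_mult)
    moreover have "cls (?R (p + a + b) c d) = cls (?R p c d)"
      using sm by (intro same) auto
    ultimately show ?thesis by (simp add: \<phi>_def z)
  qed
  have \<phi>_diag: "\<phi> (a, a) = \<one>\<^bsub>Q\<^esub>" if "a \<in> L" for a
    using small[OF that that that that] by (auto simp: \<phi>_def adjacent_exchange_same intro!: cls_N swap_N)
  have \<phi>_inv: "\<phi> (a, b) \<otimes>\<^bsub>Q\<^esub> \<phi> (b, a) = \<one>\<^bsub>Q\<^esub>" if "a \<in> L" "b \<in> L" for a b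
  proof -
    note sm = small[OF that that]
    have R: "?R p a b \<in> IET p q" "?R p b a \<in> IET p q"
      using that sm by (auto intro!: R_IET)
    have "?R p a b \<otimes>\<^bsub>G\<^esub> ?R p b a = \<one>\<^bsub>G\<^esub>"
      unfolding G_def using sm by (intro adjacent_exchange_mult_inverse) auto
    then show ?thesis using R cls_one by (simp add: \<phi>_def flip: cls_mult)
  qed
  have "\<exists>zs. set zs \<subseteq> L \<times> L \<and> cls h = Q.list_mult \<phi> zs
      \<and> SAF p q h = (\<Sum>(c, d)\<leftarrow>zs. tensor c d - tensor d c) \<and> h \<in> IET p q"
    if "h \<in> generate G (adjacent_exchanges p q L)" for h
    using that
  proof induction
    case one
    show ?case
      using cls_one pq one_closed by (intro exI[of _ "[]"]) (simp add: G_def SAF_one)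
  next
    case (incl h)
    then obtain x a b where h: "h = ?R x a b" "a \<in> L" "b \<in> L" "p \<le> x" "x + a + b \<le> q"
      by (auto simp: adjacent_exchanges_def)
    note sm = small[OF h(2,3) h(2,3)]
    have "cls h = \<phi> (a, b)" unfolding h(1) \<phi>_def using same[of a b x] sm h by simp
    moreover have "\<phi> (a, b) \<in> carrier Q" using \<phi>_closed h(2,3) by blast
    moreover have "SAF p q h = tensor a b - tensor b a"
      unfolding h(1) using sm h(4,5) by (intro SAF_adjacent_exchange) auto
    moreover have "h \<in> IET p q" unfolding h(1) by (rule R_IET[OF h(2-5)])
    ultimately show ?case
      using h(2,3) by (intro exI[of _ "[(a, b)]"]) simp
  next
    case (inv h)
    then obtain x a b where h: "h = ?R x a b" "a \<in> L" "b \<in> L" "p \<le> x" "x + a + b \<le> q"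
      by (auto simp: adjacent_exchanges_def)
    note sm = small[OF h(2,3) h(2,3)]
    have R: "?R x a b \<in> IET p q" "?R x b a \<in> IET p q"
      using h by (auto intro!: R_IET)
    have "?R x b a \<otimes>\<^bsub>G\<^esub> ?R x a b = \<one>\<^bsub>G\<^esub>"
      unfolding G_def using sm h by (intro adjacent_exchange_mult_inverse) auto
    then have inv_h: "inv\<^bsub>G\<^esub> h = ?R x b a"
      unfolding h(1) using R by (intro inv_equality) auto
    have "cls (inv\<^bsub>G\<^esub> h) = \<phi> (b, a)" unfolding inv_h \<phi>_def using same[of b a x] sm h by simp
    moreover have "\<phi> (b, a) \<in> carrier Q" using \<phi>_closed h(2,3) by blast
    moreover have "SAF p q (inv\<^bsub>G\<^esub> h) = tensor b a - tensor a b"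
      unfolding inv_h using sm h(4,5) by (intro SAF_adjacent_exchange) auto
    moreover have "inv\<^bsub>G\<^esub> h \<in> IET p q" unfolding inv_h by (rule R(2))
    ultimately show ?case
      using h(2,3) by (intro exI[of _ "[(b, a)]"]) simp
  next
    case (eng g h)
    then obtain us vs where us: "set us \<subseteq> L \<times> L" "cls g = Q.list_mult \<phi> us"
        "SAF p q g = (\<Sum>(c, d)\<leftarrow>us. tensor c d - tensor d c)" "g \<in> IET p q"
      and vs: "set vs \<subseteq> L \<times> L" "cls h = Q.list_mult \<phi> vs"
        "SAF p q h = (\<Sum>(c, d)\<leftarrow>vs. tensor c d - tensor d c)" "h \<in> IET p q"
      by blast
    have "\<phi> ` set us \<subseteq> carrier Q" "\<phi> ` set vs \<subseteq> carrier Q"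
      using us(1) vs(1) \<phi>_closed by blast+
    then have "cls (g \<otimes>\<^bsub>G\<^esub> h) = Q.list_mult \<phi> (us @ vs)"
      using us vs by (simp add: cls_mult Q.list_mult_append)
    moreover have "SAF p q (g \<otimes>\<^bsub>G\<^esub> h) = (\<Sum>(c, d)\<leftarrow>us @ vs. tensor c d - tensor d c)"
      using us vs by (simp add: G_def SAF_mult)
    ultimately show ?case
      using us vs m_closed[of g h] by (intro exI[of _ "us @ vs"]) auto
  qed
  from this[OF \<open>f \<in> generate G (adjacent_exchanges p q L)\<close>]
  obtain zs where zs: "set zs \<subseteq> L \<times> L" "cls f = Q.list_mult \<phi> zs"
      "(\<Sum>(c, d)\<leftarrow>zs. tensor c d - tensor d c) = 0"
    unfolding f(2) by auto
  have "Q.list_mult \<phi> zs = \<one>\<^bsub>Q\<^esub>"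
  proof (rule Q.list_mult_balanced)
    show "\<phi> ` set zs \<subseteq> carrier Q" using zs(1) \<phi>_closed by blast
    show "\<phi> z \<otimes>\<^bsub>Q\<^esub> \<phi> w = \<phi> w \<otimes>\<^bsub>Q\<^esub> \<phi> z" if "z \<in> set zs" "w \<in> set zs" for z w
      using that zs(1) by (intro \<phi>_comm) auto
    show "\<phi> (a, a) = \<one>\<^bsub>Q\<^esub>" if "(a, a) \<in> set zs" for a
      using that zs(1) by (intro \<phi>_diag) auto
    show "\<phi> (a, b) \<otimes>\<^bsub>Q\<^esub> \<phi> (b, a) = \<one>\<^bsub>Q\<^esub>" if "(a, b) \<in> set zs" for a b
      using that zs(1) by (intro \<phi>_inv) auto
    show "count_list zs (a, b) = count_list zs (b, a)" if "a \<noteq> b" for a b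
      using tensor_wedge_counts[OF L(1,3) zs(1,3) that] .
  qed
  then show ?thesis using N_cls zs(2) f(1) by simp
qed


section \<open>The four subgroups\<close>

text \<open>
  Conjugation preserves orders.
\<close>

lemma (in group) generate_ord_normal: "generate G {f \<in> carrier G. ord f = n} \<lhd> G"
proof (rule normal_generateI)
  fix h g assume h: "h \<in> {f \<in> carrier G. ord f = n}" and g: "g \<in> carrier G"
  have hg: "h \<in> carrier G" "g \<in> carrier G" using h g by auto
  have cancel: "inv g \<otimes> (g \<otimes> u) = u" if "u \<in> carrier G" for u
    using hg that by (simp flip: m_assoc)
  have pow: "(g \<otimes> h \<otimes> inv g) [^] (k::nat) = g \<otimes> h [^] k \<otimes> inv g" for k
    by (induction k) (use hg in \<open>simp_all add: m_assoc cancel\<close>)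
  have "g \<otimes> u \<otimes> inv g = \<one> \<longleftrightarrow> u = \<one>" if u: "u \<in> carrier G" for u
  proof
    assume *: "g \<otimes> u \<otimes> inv g = \<one>"
    have "u = inv g \<otimes> (g \<otimes> u \<otimes> inv g) \<otimes> g"
      using hg u by (simp add: m_assoc cancel)
    then show "u = \<one>" unfolding * using hg by simp
  qed (use hg in simp)
  then have "(g \<otimes> h \<otimes> inv g) [^] k = \<one> \<longleftrightarrow> h [^] k = \<one>" for k :: nat
    unfolding pow using hg by simp
  then show "g \<otimes> h \<otimes> inv g \<in> {f \<in> carrier G. ord f = n}"
    using h g unfolding ord_def by simp
qed auto

theorem theorem1p1:
  fixes p q :: real
  assumes "p < q"
  shows "let G = IET_group p q in
     {f \<in> carrier G. SAF p q f = 0} = derived G (carrier G) \<and>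
     derived G (carrier G) = generate G {f \<in> carrier G. group.ord G f = 2} \<and>
     generate G {f \<in> carrier G. group.ord G f = 2} =
       generate G {f \<in> carrier G. group.ord G f \<noteq> 0}"
proof -
  define G where "G = IET_group p q"
  interpret group G unfolding G_def using assms by (intro group_IET_group) simp
  let ?K = "{f \<in> carrier G. SAF p q f = 0}"
  let ?D = "derived G (carrier G)"
  let ?T = "generate G {f \<in> carrier G. ord f = 2}" and ?F = "generate G {f \<in> carrier G. ord f \<noteq> 0}"
  have K: "subgroup ?K G"
    unfolding G_def using assms by (intro SAF_kernel_subgroup) simp
  have "?D \<subseteq> ?K"
    unfolding derived_def
  proof (rule generate_subgroup_incl[OF _ K])
    show "derived_set G (carrier G) \<subseteq> ?K"
      using SAF_commutator[of p q] assms by (auto simp: G_def[symmetric]) (auto simp: G_def)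
  qed
  moreover have "?T \<subseteq> ?F" by (rule mono_generate) auto
  moreover have "?F \<subseteq> ?K"
    using SAF_finite_order[OF assms] by (intro generate_subgroup_incl[OF _ K]) (auto simp: G_def)
  moreover have K_sub: "?K \<subseteq> N"
    if "N \<lhd> G"
      and "\<And>x y w. 0 < w \<Longrightarrow> p \<le> x \<Longrightarrow> x + w \<le> y \<Longrightarrow> y + w \<le> q \<Longrightarrow>
        restrict (interval_swap x y w) {p..<q} \<in> N"
    for N
  proof
    fix f assume "f \<in> ?K"
    then have f: "f \<in> IET p q" "SAF p q f = 0" by (simp_all add: G_def)
    show "f \<in> N"
      by (rule SAF_kernel_subset_normal[OF assms that(1)[unfolded G_def] _ f]) (rule that(2))
  qed
  have "?K \<subseteq> ?D"
    by (rule K_sub[OF derived_self_is_normal]) (unfold G_def, rule interval_swap_in_derived)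
  moreover have "?K \<subseteq> ?T"
  proof (rule K_sub[OF generate_ord_normal])
    fix x y w :: real assume *: "0 < w" "p \<le> x" "x + w \<le> y" "y + w \<le> q"
    show "restrict (interval_swap x y w) {p..<q} \<in> ?T"
      using ord_interval_swap[OF *] interval_swap_in_IET[OF *] by (intro generate.incl) (simp add: G_def)
  qed
  ultimately show ?thesis unfolding Let_def G_def[symmetric] by blast
qed

end
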